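(* Let $F$ be a Pythagorean formally real field with finitely many orderings such that $X_F$ is connected and $\operatorname{rank}X_F\neq1$. Then there exists $\tau\in\mathrm{Gal}(F^{(3)}/F(\sqrt{-1}))$ with $\chi_\tau\neq1$ (i.e. $\tau\notin\Phi_F$) such that $\chi_\tau X_F=X_F$.
   Context: $F$ has characteristic $0$; Pythagorean: every sum of two squares is a square; formally real: $-1$ is not a sum of squares. $F^{(2)}=F(\sqrt a:a\in\dot F)$, $F^{(3)}$ the compositum of all quadratic extensions $K$ of $F^{(2)}$ with $K/F$ Galois; $\mathcal G_F=\mathrm{Gal}(F^{(3)}/F)$ with Frattini subgroup $\Phi_F=\mathrm{Gal}(F^{(3)}/F^{(2)})$. $X_F$ is the set of orderings, each identified with its signature character in $\chi(\dot F/\dot F^2)$. For $\tau\in\mathcal G_F$, $\chi_\tau(a)=\tau(\sqrt a)/\sqrt a$. Two orderings $\sigma,\sigma'$ are simply connected if there are orderings $\rho,\rho'$ with $\sigma\sigma'=\rho\rho'$ (product of characters) and $\{\sigma,\sigma'\}\neq\{\rho,\rho'\}$; connectedness is the equivalence relation generated by this; $X_F$ is connected if it has one equivalence class. $\operatorname{rank}X_F$ is the $\mathbb F_2$-dimension of the subgroup of $\chi(\dot F/\dot F^2)$ generated by $X_F$. *)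

theory Defs
  imports Main "HOL-Computational_Algebra.Polynomial"
begin

definition pythagorean :: "'a::field itself \<Rightarrow> bool" where
  "pythagorean _ \<longleftrightarrow> (\<forall>x y::'a. \<exists>z. x^2 + y^2 = z^2)"

definition formally_real :: "'a::field itself \<Rightarrow> bool" where
  "formally_real _ \<longleftrightarrow> \<not> (\<exists>xs::'a list. - 1 = sum_list (map (\<lambda>x. x^2) xs))"

definition is_ordering :: "'a::field set \<Rightarrow> bool" where
  "is_ordering P \<longleftrightarrow>
     (\<forall>x\<in>P. \<forall>y\<in>P. x + y \<in> P) \<and> (\<forall>x\<in>P. \<forall>y\<in>P. x * y \<in> P) \<and>
     P \<union> uminus ` P = UNIV \<and> P \<inter> uminus ` P = {0}"

text \<open>Characters of the square class group: functions 'a => int, values +-1 on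
  nonzero elements; convention: value 1 at 0. Product of characters is pointwise.\<close>
definition signature :: "'a::field set \<Rightarrow> 'a \<Rightarrow> int" where
  "signature P a = (if a = 0 then 1 else if a \<in> P then 1 else -1)"

definition space_of_orderings :: "'a::field itself \<Rightarrow> ('a \<Rightarrow> int) set" ("X\<^sub>F") where
  "X\<^sub>F T = signature ` {P. is_ordering P}"

definition char_mult :: "('a \<Rightarrow> int) \<Rightarrow> ('a \<Rightarrow> int) \<Rightarrow> 'a \<Rightarrow> int" where
  "char_mult \<chi> \<psi> = (\<lambda>a. \<chi> a * \<psi> a)"

definition simply_connected :: "('a \<Rightarrow> int) set \<Rightarrow> ('a \<Rightarrow> int) \<Rightarrow> ('a \<Rightarrow> int) \<Rightarrow> bool" where
  "simply_connected X \<sigma> \<sigma>' \<longleftrightarrow> \<sigma> \<in> X \<and> \<sigma>' \<in> X \<and>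
     (\<exists>\<rho>\<in>X. \<exists>\<rho>'\<in>X. char_mult \<sigma> \<sigma>' = char_mult \<rho> \<rho>' \<and> {\<sigma>, \<sigma>'} \<noteq> {\<rho>, \<rho>'})"

definition connected_space :: "('a \<Rightarrow> int) set \<Rightarrow> bool" where
  "connected_space X \<longleftrightarrow> X \<noteq> {} \<and>
     (\<forall>\<sigma>\<in>X. \<forall>\<sigma>'\<in>X. equivclp (simply_connected X) \<sigma> \<sigma>')"

inductive_set char_span :: "('a \<Rightarrow> int) set \<Rightarrow> ('a \<Rightarrow> int) set" for S where
  one: "(\<lambda>_. 1) \<in> char_span S"
| mult: "\<chi> \<in> char_span S \<Longrightarrow> \<sigma> \<in> S \<Longrightarrow> char_mult \<sigma> \<chi> \<in> char_span S"

text \<open>F_2-dimension of the subgroup generated by X (an elementary abelian 2-group):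
  minimal size of a generating set.\<close>
definition rank_chars :: "('a \<Rightarrow> int) set \<Rightarrow> nat" where
  "rank_chars X = (LEAST n. \<exists>S. finite S \<and> card S = n \<and> S \<subseteq> char_span X \<and>
                               char_span S = char_span X)"

section \<open>Galois-theoretic part, inside an algebraically closed extension L (type 'b)\<close>

definition field_embedding :: "('a::field \<Rightarrow> 'b::field) \<Rightarrow> bool" where
  "field_embedding i \<longleftrightarrow> inj i \<and> i 1 = 1 \<and> (\<forall>x y. i (x + y) = i x + i y \<and> i (x * y) = i x * i y)"

definition alg_closed :: "'b::field itself \<Rightarrow> bool" where
  "alg_closed _ \<longleftrightarrow> (\<forall>p::'b poly. degree p > 0 \<longrightarrow> (\<exists>x. poly p x = 0))"

definition is_subfield :: "'b::field set \<Rightarrow> bool" where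
  "is_subfield K \<longleftrightarrow> 0 \<in> K \<and> 1 \<in> K \<and>
     (\<forall>x\<in>K. \<forall>y\<in>K. x + y \<in> K \<and> x * y \<in> K) \<and> (\<forall>x\<in>K. - x \<in> K \<and> inverse x \<in> K)"

definition field_gen :: "'b::field set \<Rightarrow> 'b set" where
  "field_gen S = \<Inter>{K. is_subfield K \<and> S \<subseteq> K}"

definition quadratic_ext :: "'b::field set \<Rightarrow> 'b set \<Rightarrow> bool" where
  "quadratic_ext E K \<longleftrightarrow> is_subfield K \<and> E \<subseteq> K \<and>
     (\<exists>u\<in>K. \<exists>v\<in>K. \<forall>x\<in>K. \<exists>!ab. fst ab \<in> E \<and> snd ab \<in> E \<and> x = fst ab * u + snd ab * v)"

definition Aut_over :: "'b::field set \<Rightarrow> 'b set \<Rightarrow> ('b \<Rightarrow> 'b) set" where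
  "Aut_over K E = {\<sigma>. bij_betw \<sigma> K K \<and>
     (\<forall>x\<in>K. \<forall>y\<in>K. \<sigma> (x + y) = \<sigma> x + \<sigma> y \<and> \<sigma> (x * y) = \<sigma> x * \<sigma> y) \<and>
     (\<forall>x\<in>E. \<sigma> x = x)}"

definition algebraic_over :: "'b::field set \<Rightarrow> 'b set \<Rightarrow> bool" where
  "algebraic_over E K \<longleftrightarrow>
     (\<forall>x\<in>K. \<exists>p::'b poly. p \<noteq> 0 \<and> (\<forall>n. coeff p n \<in> E) \<and> poly p x = 0)"

definition galois_ext :: "'b::field set \<Rightarrow> 'b set \<Rightarrow> bool" where
  "galois_ext E K \<longleftrightarrow> is_subfield K \<and> E \<subseteq> K \<and> algebraic_over E K \<and>
     (\<forall>x\<in>K. (\<forall>\<sigma>\<in>Aut_over K E. \<sigma> x = x) \<longrightarrow> x \<in> E)"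

definition F2 :: "('a::field \<Rightarrow> 'b::field) \<Rightarrow> 'b set" where
  "F2 i = field_gen (range i \<union> {y. \<exists>a. a \<noteq> 0 \<and> y^2 = i a})"

definition F3 :: "('a::field \<Rightarrow> 'b::field) \<Rightarrow> 'b set" where
  "F3 i = field_gen (\<Union>{K. quadratic_ext (F2 i) K \<and> galois_ext (range i) K})"

definition F_sqrt_m1 :: "('a::field \<Rightarrow> 'b::field) \<Rightarrow> 'b set" where
  "F_sqrt_m1 i = field_gen (range i \<union> {y. y^2 = - 1})"

definition sqrtL :: "('a::field \<Rightarrow> 'b::field) \<Rightarrow> 'a \<Rightarrow> 'b" where
  "sqrtL i a = (SOME r. r^2 = i a)"

definition chi_tau :: "('a::field \<Rightarrow> 'b::field) \<Rightarrow> ('b \<Rightarrow> 'b) \<Rightarrow> 'a \<Rightarrow> int" where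
  "chi_tau i \<tau> a = (if a = 0 then 1
                      else if \<tau> (sqrtL i a) / sqrtL i a = 1 then 1 else -1)"

end

theory Submission
  imports Defs
begin

text \<open>
  Four distinct orderings \<open>\<sigma>, \<sigma>', \<rho>, \<rho>'\<close> with \<open>\<sigma>\<sigma>' = \<rho>\<rho>'\<close> have a common convex subring \<open>A\<close> of \<open>F\<close>
  on whose units some product \<open>\<gamma> \<noteq> 1\<close> of two of them is trivial. Indeed, for a suitable \<open>\<gamma>\<close> every
  \<open>y\<close> with \<open>\<gamma>(y) = -1\<close> has absolute value less than \<open>1\<close> for all four orderings or for none, and \<open>A\<close>
  consists of the elements that are smaller than all such \<open>y\<close> with \<open>\<bar>y\<bar> > 1\<close>.
  The subrings that are convex for a fixed ordering form a chain, and overrings of convex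
  subrings are convex. Hence a maximal \<open>A\<close> among the finitely many simply connected pairs is
  convex for one ordering after another along the connections, so for all of \<open>X\<^sub>F\<close>,
  and by Baer--Krull \<open>\<gamma>X\<^sub>F = X\<^sub>F\<close>.

  It remains to realise \<open>\<gamma>\<close> as \<open>\<chi>\<^sub>\<tau>\<close>. Zorn's lemma gives a maximal partial embedding of the
  algebraically closed field that fixes \<open>F\<close> and maps \<open>\<surd>a\<close> to \<open>\<gamma>(a)\<surd>a\<close>. Its domain is closed
  under square roots, so it contains \<open>F\<^sup>(\<^sup>3\<^sup>)\<close>, and the embedding maps
  each of the Galois extensions generating \<open>F\<^sup>(\<^sup>3\<^sup>)\<close> onto itself.
\<close>

section \<open>Orderings and convex subrings\<close>

text \<open>Orderings are handled through their sign functions. Because \<open>s 0 = 1\<close>, the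
  equation \<open>s x = 1\<close> reads x >= 0 and \<open>s x = -1\<close> reads x < 0.\<close>

locale sign_char =
  fixes s :: "'a::field_char_0 \<Rightarrow> int"
  assumes zero [simp]: "s 0 = 1"
    and cases: "s x = 1 \<or> s x = -1"
    and mult: "x \<noteq> 0 \<Longrightarrow> y \<noteq> 0 \<Longrightarrow> s (x * y) = s x * s y"
    and minus_one: "s (-1) = -1"
    and add: "s x = 1 \<Longrightarrow> s y = 1 \<Longrightarrow> s (x + y) = 1"
begin

lemma not_one [simp]: "s x \<noteq> 1 \<longleftrightarrow> s x = -1"
  using cases[of x] by auto

lemma neq_zero [simp]: "s x \<noteq> 0"
  using cases[of x] by auto

lemma square_one [simp]: "s x * s x = 1"
  using cases[of x] by auto

lemma one [simp]: "s 1 = 1"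
  using mult[of 1 1] cases[of 1] by auto

lemma minus: "x \<noteq> 0 \<Longrightarrow> s (- x) = - s x"
  using mult[of "-1" x] minus_one by simp

lemma nonzero: "s x = -1 \<Longrightarrow> x \<noteq> 0"
  by auto

lemma minus_neg: "s x = -1 \<Longrightarrow> s (- x) = 1"
  using minus[of x] nonzero[of x] by simp

lemma mult_nonneg: "s x = 1 \<Longrightarrow> s y = 1 \<Longrightarrow> s (x * y) = 1"
  by (cases "x = 0 \<or> y = 0") (auto simp: mult)

lemma square [simp]: "s (x\<^sup>2) = 1"
  by (cases "x = 0") (auto simp: mult power2_eq_square)

lemma of_nat_nonneg [simp]: "s (of_nat n) = 1"
  by (induction n) (auto intro: add)

lemma numeral_nonneg [simp]: "s (numeral n) = 1"
  by (metis of_nat_nonneg of_nat_numeral)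

lemma mult_square: "y \<noteq> 0 \<Longrightarrow> s (x * y\<^sup>2) = s x"
  by (cases "x = 0") (auto simp: mult)

lemma divide: "x \<noteq> 0 \<Longrightarrow> y \<noteq> 0 \<Longrightarrow> s (x / y) = s x * s y"
  using mult_square[of y "x / y"] mult[of x y] by (simp add: power2_eq_square)

lemma total: "s (x - y) = 1 \<or> s (y - x) = 1"
  using minus_neg[of "x - y"] cases[of "x - y"] by auto

lemma trans: "s (x - y) = 1 \<Longrightarrow> s (y - z) = 1 \<Longrightarrow> s (x - z) = 1"
  using add[of "x - y" "y - z"] by simp

lemma add_pos: "s x = 1 \<Longrightarrow> s y = 1 \<Longrightarrow> x \<noteq> 0 \<Longrightarrow> x + y \<noteq> 0"
  using minus[of x] by (metis add_eq_0_iff one_neq_neg_one)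

end

lemma sign_char_signature:
  fixes P :: "'a::field_char_0 set"
  assumes "is_ordering P"
  shows "sign_char (signature P)"
proof -
  have add: "x \<in> P \<Longrightarrow> y \<in> P \<Longrightarrow> x + y \<in> P" 
    and mul: "x \<in> P \<Longrightarrow> y \<in> P \<Longrightarrow> x * y \<in> P" for x y
    using assms by (auto simp: is_ordering_def)
  have un: "x \<in> P \<or> - x \<in> P" for x
  proof -
    have "x \<in> P \<union> uminus ` P" using assms by (auto simp: is_ordering_def)
    then show ?thesis by auto
  qed
  have int: "x = 0" if "x \<in> P" "- x \<in> P" for x
  proof -
    have "x \<in> P \<inter> uminus ` P" using that by (auto intro: image_eqI[of _ _ "- x"])
    then show ?thesis using assms by (auto simp: is_ordering_def)
  qed
  have z: "0 \<in> P" using un[of 0] by simp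
  have one: "1 \<in> P" using un[of 1] mul[of "-1" "-1"] by auto
  have mone: "-1 \<notin> P" using int[of 1] one by auto
  have neg: "x \<notin> P \<Longrightarrow> y \<notin> P \<Longrightarrow> x * y \<in> P" for x y
    using un[of x] un[of y] mul[of "- x" "- y"] by auto
  have mixed: "x * y \<notin> P" if "x \<in> P" "y \<notin> P" "x \<noteq> 0" for x y
  proof
    assume "x * y \<in> P"
    moreover have "- (x * y) \<in> P" using mul[of x "- y"] un[of y] that by auto
    ultimately have "x * y = 0" using int by blast
    then show False using that z by auto
  qed
  show ?thesis
  proof
    fix x y :: 'a
    show "signature P (x * y) = signature P x * signature P y" if "x \<noteq> 0" "y \<noteq> 0"
      using that mul[of x y] neg[of x y] mixed[of x y] mixed[of y x]
      by (auto simp: signature_def mult.commute)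
    show "signature P (x + y) = 1" if "signature P x = 1" "signature P y = 1"
      using that add[of x y] by (auto simp: signature_def split: if_splits)
  qed (auto simp: signature_def mone)
qed

lemma sign_char_is_signature:
  assumes "sign_char (s :: 'a::field_char_0 \<Rightarrow> int)"
  shows "\<exists>P. is_ordering P \<and> s = signature P"
proof -
  interpret sign_char s by fact
  have "is_ordering {x. s x = 1}"
    unfolding is_ordering_def
  proof (intro conjI)
    have "x \<in> uminus ` {x. s x = 1}" if "s x \<noteq> 1" for x
      using that minus_neg[of x] by (intro image_eqI[of _ _ "- x"]) auto
    then show "{x. s x = 1} \<union> uminus ` {x. s x = 1} = UNIV" by blast
    have "x = 0" if "s x = 1" "s (- x) = 1" for x
      using that minus[of x] by force
    then show "{x. s x = 1} \<inter> uminus ` {x. s x = 1} = {0}"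
      by (auto intro: image_eqI[of _ _ 0])
  qed (auto intro: add mult_nonneg)
  moreover have "s = signature {x. s x = 1}"
    by (rule ext) (auto simp: signature_def)
  ultimately show ?thesis by blast
qed

lemma space_of_orderings_iff:
  "s \<in> X\<^sub>F TYPE('a::field_char_0) \<longleftrightarrow> sign_char s"
  using sign_char_signature sign_char_is_signature
  unfolding space_of_orderings_def by blast

section \<open>Convex subrings and twisting in the manner of Baer-Krull\<close>

text \<open>Closure under negation comes from absolute convexity: a and - a have the same square,
  and \<open>s 0 = 1\<close>.\<close>

definition unital_subring :: "'a::field_char_0 set \<Rightarrow> bool" where
  "unital_subring A \<longleftrightarrow> 1 \<in> A \<and> (\<forall>x\<in>A. \<forall>y\<in>A. x + y \<in> A \<and> x * y \<in> A)"

text \<open>For a sign character \<open>s\<close> the condition \<open>s (a\<^sup>2 - b\<^sup>2) = 1\<close> says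
  \<open>\<bar>b\<bar> \<le> \<bar>a\<bar>\<close>, because \<open>s 0 = 1\<close>.\<close>

definition abs_convex :: "('a::field_char_0 \<Rightarrow> int) \<Rightarrow> 'a set \<Rightarrow> bool" where
  "abs_convex s A \<longleftrightarrow> (\<forall>a\<in>A. \<forall>b. s (a\<^sup>2 - b\<^sup>2) = 1 \<longrightarrow> b \<in> A)"

text \<open>For a convex subring A, which is a valuation ring, this says that the product of s and t
  factors through the value group.\<close>

definition agree_on_units :: "('a::field_char_0 \<Rightarrow> int) \<Rightarrow> ('a \<Rightarrow> int) \<Rightarrow> 'a set \<Rightarrow> bool" where
  "agree_on_units s t A \<longleftrightarrow> (\<forall>u\<in>A. u \<noteq> 0 \<longrightarrow> inverse u \<in> A \<longrightarrow> s u = t u)"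

text \<open>An element of A outside B exceeds every element of B in absolute value, so B lies in
  A.\<close>

lemma abs_convex_chain:
  assumes "sign_char s" "abs_convex s A" "abs_convex s B"
  shows "A \<subseteq> B \<or> B \<subseteq> A"
proof -
  interpret sign_char s by fact
  show ?thesis using assms(2,3) total unfolding abs_convex_def by blast
qed

text \<open>From |c| <= |b| follows |c / b| <= 1, so c / b lies already in A, and c = b (c / b) lies
  in B.\<close>

lemma abs_convex_overring:
  assumes "sign_char s" "abs_convex s A" "unital_subring A" "unital_subring B" "A \<subseteq> B"
  shows "abs_convex s B"
  unfolding abs_convex_def
proof (intro ballI allI impI)
  interpret sign_char s by fact
  fix b c assume b: "b \<in> B" and le: "s (b\<^sup>2 - c\<^sup>2) = 1"
  show "c \<in> B"
  proof (cases "b = 0")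
    case True
    then have "c = 0" using le minus[of "c\<^sup>2"] by force
    then show ?thesis using True b by simp
  next
    case False
    have "(1\<^sup>2 - (c / b)\<^sup>2) * b\<^sup>2 = b\<^sup>2 - c\<^sup>2"
      using False by (simp add: field_simps)
    then have "s (1\<^sup>2 - (c / b)\<^sup>2) = 1"
      using mult_square[OF False, of "1\<^sup>2 - (c / b)\<^sup>2"] le by simp
    then have "c / b \<in> B"
      using assms(2,3,5) unfolding abs_convex_def unital_subring_def by blast
    then have "b * (c / b) \<in> B"
      using b assms(4) unfolding unital_subring_def by blast
    then show ?thesis using False by simp
  qed
qed

text \<open>Baer--Krull. For \<open>0 < \<bar>a\<bar> \<le> \<bar>b\<bar>\<close> the point is that \<open>1 + a / b\<close> is a positive unit of \<open>A\<close>.\<close>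

lemma sign_char_twist:
  assumes "sign_char s" "sign_char t" "sign_char t'"
    and ring: "unital_subring A" and conv: "abs_convex s A" and agree: "agree_on_units t t' A"
  shows "sign_char (char_mult (char_mult t t') s)"
proof -
  interpret s: sign_char s by fact
  interpret t: sign_char t by fact
  interpret t': sign_char t' by fact
  define \<gamma> where "\<gamma> x = t x * t' x" for x
  define r where "r x = \<gamma> x * s x" for x
  have g_mult: "\<gamma> (x * y) = \<gamma> x * \<gamma> y" if "x \<noteq> 0" "y \<noteq> 0" for x y
    using that by (simp add: \<gamma>_def t.mult t'.mult)
  have g_div: "\<gamma> (x / y) = \<gamma> x * \<gamma> y" if "x \<noteq> 0" "y \<noteq> 0" for x y
    using that by (simp add: \<gamma>_def t.divide t'.divide)
  have g_cases: "\<gamma> x = 1 \<or> \<gamma> x = -1" for x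
    using t.cases[of x] t'.cases[of x] by (auto simp: \<gamma>_def)
  have r_mult: "r (x * y) = r x * r y" if "x \<noteq> 0" "y \<noteq> 0" for x y
    using that by (simp add: r_def g_mult s.mult)
  have g_unit: "\<gamma> u = 1" if "u \<in> A" "u \<noteq> 0" "inverse u \<in> A" for u
    using agree that by (auto simp: \<gamma>_def agree_on_units_def)
  have convI: "b \<in> A" if "a \<in> A" "s (a\<^sup>2 - b\<^sup>2) = 1" for a b
    using conv that by (auto simp: abs_convex_def)
  have A1: "1 \<in> A" and Aadd: "x \<in> A \<Longrightarrow> y \<in> A \<Longrightarrow> x + y \<in> A" for x y
    using ring by (auto simp: unital_subring_def)
  have A2: "2 \<in> A" using Aadd[OF A1 A1] by simp
  have main: "r (a + b) = 1"
    if le: "s (b\<^sup>2 - a\<^sup>2) = 1" and ab: "r a = 1" "r b = 1" "a \<noteq> 0" "b \<noteq> 0" for a b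
  proof -
    define u where "u = a / b"
    have u0: "u \<noteq> 0" using ab by (simp add: u_def)
    have a: "a = u * b" using ab by (simp add: u_def)
    have "(1\<^sup>2 - u\<^sup>2) * b\<^sup>2 = b\<^sup>2 - a\<^sup>2"
      by (simp add: a power_mult_distrib algebra_simps)
    then have uA: "u \<in> A" using convI[OF A1, of u] s.mult_square[OF ab(4), of "1\<^sup>2 - u\<^sup>2"] le by simp
    \<comment> \<open>If 1 / |1 + u| <= |c| with c in A, convexity puts the inverse of 1 + u into A.
      This is used for c = 1 and c = 2.\<close>
    have inv: "inverse (1 + u) \<in> A" if "1 + u \<noteq> 0" "c \<in> A" "s (c\<^sup>2 * (1 + u)\<^sup>2 - 1) = 1" for c
    proof -
      have "(c\<^sup>2 - (inverse (1 + u))\<^sup>2) * (1 + u)\<^sup>2 = c\<^sup>2 * (1 + u)\<^sup>2 - 1"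
        using that(1) by (simp add: left_diff_distrib flip: power_mult_distrib)
      then show ?thesis using convI[OF that(2)] that(3) s.mult_square[OF that(1)] by metis
    qed
    have "1 + u \<noteq> 0 \<and> s (1 + u) = 1 \<and> inverse (1 + u) \<in> A"
    proof (cases "inverse u \<in> A")
      case True
      \<comment> \<open>For a unit u the twist takes the same value at a and b. Hence s a = s b, so
        u > 0 and 1 + u > 1.\<close>
      have "\<gamma> a = \<gamma> b"
        using g_unit[OF uA u0 True] g_div[of a b] ab g_cases[of a] g_cases[of b] by (auto simp: u_def)
      then have su: "s u = 1"
        using ab s.divide[of a b] g_cases[of b] by (auto simp: u_def r_def)
      have n: "1 + u \<noteq> 0" and p: "s (1 + u) = 1"
        using s.add_pos[of 1 u] s.add[of 1 u] su by auto
      have "1\<^sup>2 * (1 + u)\<^sup>2 - 1 = u\<^sup>2 + 2 * u" by (simp add: power2_eq_square algebra_simps)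
      moreover have "s (u\<^sup>2 + 2 * u) = 1" using su by (intro s.add s.mult_nonneg) auto
      ultimately show ?thesis using inv[OF n A1] n p by simp
    next
      case False
      \<comment> \<open>A non-unit u has |1 / u| > 2, since 2 lies in A. Hence |u| < 1/2, and 1 + u
        > 1/2 whatever the sign of u.\<close>
      have "s (2\<^sup>2 - (inverse u)\<^sup>2) \<noteq> 1" using convI[OF A2] False by blast
      moreover have "(2\<^sup>2 - (inverse u)\<^sup>2) * u\<^sup>2 = (2 * u - 1) * (2 * u + 1)"
        using u0 by (simp add: field_simps power2_eq_square)
      ultimately have neg: "s ((2 * u - 1) * (2 * u + 1)) \<noteq> 1"
        using s.mult_square[OF u0, of "2\<^sup>2 - (inverse u)\<^sup>2"] by simp
      have p2: "s (1 + 2 * u) = 1"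
      proof (rule ccontr)
        assume "s (1 + 2 * u) \<noteq> 1"
        then have m: "s (- (1 + 2 * u)) = 1" using s.minus_neg s.not_one by blast
        then have "s (- (1 + 2 * u) + 2) = 1" by (intro s.add) auto
        from s.mult_nonneg[OF this m] neg show False by (simp add: algebra_simps)
      qed
      have e: "(1 + u) * 2 = 1 + (1 + 2 * u)" by simp
      have n: "1 + u \<noteq> 0"
        using s.add_pos[of 1 "1 + 2 * u"] p2 e by (metis mult_zero_left one_neq_zero s.one)
      have p: "s (1 + u) = 1"
        using s.add[of 1 "1 + 2 * u"] p2 s.mult[OF n, of 2] by (simp flip: e)
      have "s ((1 + 2 * u) * (1 + 2 * u + 2)) = 1"
        by (intro s.mult_nonneg[OF p2] s.add[OF p2]) simp
      moreover have "2\<^sup>2 * (1 + u)\<^sup>2 - 1 = (1 + 2 * u) * (1 + 2 * u + 2)"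
        by (simp add: power2_eq_square algebra_simps)
      ultimately show ?thesis using inv[OF n A2] n p by simp
    qed
    then have "r (1 + u) = 1" "1 + u \<noteq> 0"
      using g_unit[of "1 + u"] Aadd[OF A1 uA] by (auto simp: r_def)
    then have "r ((1 + u) * b) = 1" using r_mult[of "1 + u" b] ab by simp
    then show ?thesis by (simp add: a algebra_simps)
  qed
  have "sign_char r"
  proof
    fix x y
    show "r 0 = 1" by (simp add: r_def \<gamma>_def)
    show "r x = 1 \<or> r x = -1" using g_cases[of x] s.cases[of x] by (auto simp: r_def)
    show "r (-1) = -1" by (simp add: r_def \<gamma>_def s.minus_one t.minus_one t'.minus_one)
    show "x \<noteq> 0 \<Longrightarrow> y \<noteq> 0 \<Longrightarrow> r (x * y) = r x * r y" by (rule r_mult)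
    show "r (x + y) = 1" if xy: "r x = 1" "r y = 1"
      using main[of x y] main[of y x] s.total[of "x\<^sup>2" "y\<^sup>2"] xy
      by (cases "x = 0 \<or> y = 0") (auto simp: add.commute)
  qed
  moreover have "r = char_mult (char_mult t t') s"
    by (auto simp: r_def \<gamma>_def char_mult_def)
  ultimately show ?thesis by simp
qed

text \<open>The subring consists of all \<open>x\<close> with \<open>\<bar>x\<bar> < \<bar>w\<bar>\<close> for every \<open>w\<close> such that \<open>\<bar>w\<bar> > 1\<close> and
  \<open>t w \<noteq> t' w\<close>. It is closed under addition because with \<open>w\<close> also \<open>\<plusminus>w - 1\<close>, for one of the signs,
  has both properties, which forces \<open>\<bar>w\<bar> > 2\<close>.\<close>

lemma convex_subring_of_uniform:
  assumes Q: "\<And>s. s \<in> Q \<Longrightarrow> sign_char s" and t: "t \<in> Q" "t' \<in> Q"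
    and uniform: "\<And>y s s'. y \<noteq> 0 \<Longrightarrow> t y \<noteq> t' y \<Longrightarrow> s \<in> Q \<Longrightarrow> s' \<in> Q \<Longrightarrow>
      s (1 - y\<^sup>2) = s' (1 - y\<^sup>2)"
  shows "\<exists>A. unital_subring A \<and> (\<forall>s\<in>Q. abs_convex s A) \<and> agree_on_units t t' A"
proof -
  interpret t: sign_char t using Q t by blast
  interpret t': sign_char t' using Q t by blast
  \<comment> \<open>The elements with |w| > 1 at which t and t' differ; by \<open>uniform\<close>
    the size condition is the same for every ordering in Q.\<close>
  define W where "W = {w. w \<noteq> 0 \<and> t w \<noteq> t' w \<and> t (1 - w\<^sup>2) = -1}"
  \<comment> \<open>The ordering is a parameter here. \<open>A_sub\<close> shows that all of Q give
    the same set, so the ring laws are checked for t alone.\<close>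
  define A :: "(_ \<Rightarrow> int) \<Rightarrow> _" where "A = (\<lambda>s. {x. \<forall>w\<in>W. s (x\<^sup>2 - w\<^sup>2) = -1})"
  have W_neg: "s (1 - w\<^sup>2) = -1" if "w \<in> W" "s \<in> Q" for s w
    using uniform[of w s t] that t by (auto simp: W_def)
  have le_one: "s (1 - x\<^sup>2) = 1"
    if x: "x \<in> A s'" "x \<noteq> 0" "t x \<noteq> t' x" and s: "s \<in> Q" "s' \<in> Q" for s s' x
  proof -
    interpret s': sign_char s' using Q s by blast
    have "x \<notin> W" using x by (auto simp: A_def)
    then have "t (1 - x\<^sup>2) = 1" using x by (simp add: W_def flip: t.not_one)
    then show ?thesis using uniform[of x s t] x s t by simp
  qed
  have A_sub: "A s \<subseteq> A s'" if s: "s \<in> Q" "s' \<in> Q" for s s'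
  proof
    interpret s: sign_char s using Q s by blast
    interpret s': sign_char s' using Q s by blast
    fix x assume x: "x \<in> A s"
    have "s' (x\<^sup>2 - w\<^sup>2) = -1" if w: "w \<in> W" for w
    \<comment> \<open>If t and t' agree at x, they differ at w / x, and \<open>uniform\<close>
      applies to the comparison of |w / x| with 1. Otherwise |x| <= 1 < |w|.\<close>
    proof (cases "x \<noteq> 0 \<and> t x = t' x")
      case True
      then have "t (w / x) \<noteq> t' (w / x)" "w / x \<noteq> 0"
        using w by (auto simp: W_def t.divide t'.divide)
      then have "s (1 - (w / x)\<^sup>2) = s' (1 - (w / x)\<^sup>2)" using uniform s by blast
      moreover have "x\<^sup>2 - w\<^sup>2 = (1 - (w / x)\<^sup>2) * x\<^sup>2"
        using True by (simp add: field_simps)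
      ultimately have "s (x\<^sup>2 - w\<^sup>2) = s' (x\<^sup>2 - w\<^sup>2)"
        using True s.mult_square[of x "1 - (w / x)\<^sup>2"] s'.mult_square[of x "1 - (w / x)\<^sup>2"]
        by simp
      then show ?thesis using x w by (auto simp: A_def)
    next
      case False
      have "s' (1 - x\<^sup>2) = 1"
        using False le_one[OF x _ _ s(2) s(1)] by (cases "x = 0") auto
      then show ?thesis using W_neg[OF w s(2)] s'.trans s'.not_one by metis
    qed
    then show "x \<in> A s'" by (simp add: A_def)
  qed
  have half: "w / 2 \<in> W" if w: "w \<in> W" for w
  proof -
    \<comment> \<open>Here s is that one of t, t' with w > 0, and s' is the other. They differ at w
      - 1 too, and |w - 1| > 1 for s' because w < 0 there. So |w - 1| > 1 for s as well, which means
      w > 2.\<close>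
    have aux: "s (1 - (w / 2)\<^sup>2) = -1"
      if st: "s \<in> Q" "s' \<in> Q" "{s, s'} = {t, t'}" and w: "w \<in> W" "s w = 1" "s' w = -1" for s s' w
    proof -
      interpret s: sign_char s using Q st by blast
      interpret s': sign_char s' using Q st by blast
      have w0: "w \<noteq> 0" using w by (simp add: W_def)
      have "1 - w\<^sup>2 = (1 - w) * (1 + w)" by (simp add: power2_eq_square algebra_simps)
      then have "s (1 - w) \<noteq> 1"
        using W_neg[OF w(1) st(1)] s.mult_nonneg[of "1 - w" "1 + w"] s.add[of 1 w] w(2) by (metis s.not_one s.one)
      then have sw: "s (1 - w) = -1" and sw': "s (w - 1) = 1" using s.minus_neg[of "1 - w"] by auto
      have s'w: "s' (1 - w) = 1" using s'.add[of 1 "- w"] s'.minus_neg[OF w(3)] by simp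
      have n: "w - 1 \<noteq> 0" using sw by auto
      have "s' (w - 1) = -1" using s'.minus[OF n] s'w by simp
      then have "t (w - 1) \<noteq> t' (w - 1)" using sw' st(3) by (auto simp: doubleton_eq_iff)
      then have eq: "s (1 - (w - 1)\<^sup>2) = s' (1 - (w - 1)\<^sup>2)" using uniform n st by blast
      have e: "1 - (w - 1)\<^sup>2 = w * (1 + (1 - w))" by (simp add: power2_eq_square algebra_simps)
      have n2: "1 + (1 - w) \<noteq> 0" using s'.add_pos[of 1 "1 - w"] s'w by simp
      have "s' (w * (1 + (1 - w))) = -1"
        using s'.mult[OF w0 n2] s'.add[of 1 "1 - w"] s'w w by simp
      then have "s (w * (1 + (1 - w))) = -1" using eq e by simp
      then have "s (1 + (1 - w)) = -1" using s.mult[OF w0 n2] w by simp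
      moreover have n3: "2 + w \<noteq> 0" and "s (2 + w) = 1"
        using s.add_pos[of 2 w] s.add[of 2 w] w by auto
      ultimately have "s ((1 + (1 - w)) * (2 + w)) = -1" using s.mult[OF n2 n3] by simp
      moreover have "(1 + (1 - w)) * (2 + w) = (1 - (w / 2)\<^sup>2) * 2\<^sup>2"
        by (simp add: power2_eq_square field_simps)
      ultimately show ?thesis using s.mult_square[of 2 "1 - (w / 2)\<^sup>2"] by simp
    qed
    have w0: "w \<noteq> 0" "t w \<noteq> t' w" using w by (auto simp: W_def)
    have nz: "w / 2 \<noteq> 0" "t (w / 2) \<noteq> t' (w / 2)"
      using w0 by (auto simp: t.divide t'.divide)
    have "t (1 - (w / 2)\<^sup>2) = -1"
    proof (cases "t w = 1")
      case True
      then have "t' w = -1" using w0 t'.cases[of w] by auto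
      then show ?thesis using aux[OF t _ w True] by blast
    next
      case False
      then have "t w = -1" "t' w = 1" using w0 t.cases[of w] t'.cases[of w] by auto
      then have "t' (1 - (w / 2)\<^sup>2) = -1" using aux[of t' t w] t w by blast
      then show ?thesis using uniform[OF nz t] by simp
    qed
    then show ?thesis using nz by (simp add: W_def)
  qed
  \<comment> \<open>|x + y| <= |2 x| < |w|, the second inequality because w / 2 is in W.\<close>
  have add: "x + y \<in> A t" if le: "t (x\<^sup>2 - y\<^sup>2) = 1" and x: "x \<in> A t" for x y
  proof -
    have "t ((x + y)\<^sup>2 - w\<^sup>2) = -1" if "w \<in> W" for w
    proof -
      have "t (x\<^sup>2 - (w / 2)\<^sup>2) = -1" using x half[OF that] by (auto simp: A_def)
      moreover have "(2 * x)\<^sup>2 - w\<^sup>2 = (x\<^sup>2 - (w / 2)\<^sup>2) * 2\<^sup>2"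
        by (simp add: power2_eq_square field_simps)
      ultimately have 1: "t ((2 * x)\<^sup>2 - w\<^sup>2) = -1"
        using t.mult_square[of 2 "x\<^sup>2 - (w / 2)\<^sup>2"] by (metis zero_neq_numeral)
      have "t (2 * (x\<^sup>2 - y\<^sup>2) + (x - y)\<^sup>2) = 1"
        using le by (intro t.add t.mult_nonneg) auto
      moreover have "2 * (x\<^sup>2 - y\<^sup>2) + (x - y)\<^sup>2 = (2 * x)\<^sup>2 - (x + y)\<^sup>2"
        by (simp add: power2_eq_square algebra_simps)
      ultimately have "t ((2 * x)\<^sup>2 - (x + y)\<^sup>2) = 1" by metis
      with 1 show ?thesis using t.trans t.not_one by metis
    qed
    then show ?thesis by (simp add: A_def)
  qed
  have mult: "x * y \<in> A t" if x: "x \<in> A t" and y: "y \<in> A t" for x y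
  proof -
    have "t ((x * y)\<^sup>2 - w\<^sup>2) = -1" if w: "w \<in> W" for w
    \<comment> \<open>Agreement of t and t' at x puts w / x into W as well. Otherwise |x| <= 1 and
      |x y| <= |y|.\<close>
    proof (cases "x \<noteq> 0 \<and> t x = t' x")
      case True
      have e: "(1 - (w / x)\<^sup>2) * x\<^sup>2 = x\<^sup>2 - w\<^sup>2" using True by (simp add: field_simps)
      have "t (x\<^sup>2 - w\<^sup>2) = -1" using x w by (auto simp: A_def)
      then have "t (1 - (w / x)\<^sup>2) = -1" using t.mult_square[of x "1 - (w / x)\<^sup>2"] True e by simp
      then have "w / x \<in> W" using w True by (auto simp: W_def t.divide t'.divide)
      then have "t (y\<^sup>2 - (w / x)\<^sup>2) = -1" using y by (auto simp: A_def)
      moreover have "(y\<^sup>2 - (w / x)\<^sup>2) * x\<^sup>2 = (x * y)\<^sup>2 - w\<^sup>2"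
        using True by (simp add: field_simps)
      ultimately show ?thesis using t.mult_square[of x "y\<^sup>2 - (w / x)\<^sup>2"] True by simp
    next
      case False
      have "t (1 - x\<^sup>2) = 1"
        using False le_one[OF x _ _ t(1) t(1)] by (cases "x = 0") auto
      then have "t (y\<^sup>2 * (1 - x\<^sup>2)) = 1" by (intro t.mult_nonneg) auto
      then have "t (y\<^sup>2 - (x * y)\<^sup>2) = 1" by (simp add: power_mult_distrib algebra_simps)
      moreover have "t (y\<^sup>2 - w\<^sup>2) = -1" using y w by (auto simp: A_def)
      ultimately show ?thesis using t.trans t.not_one by metis
    qed
    then show ?thesis by (simp add: A_def)
  qed
  have "unital_subring (A t)"
    unfolding unital_subring_def
  proof (intro conjI ballI)
    show "1 \<in> A t" by (auto simp: A_def W_def)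
    fix x y assume "x \<in> A t" "y \<in> A t"
    then show "x * y \<in> A t" "x + y \<in> A t"
      using mult add[of x y] add[of y x] t.total[of "x\<^sup>2" "y\<^sup>2"] by (auto simp: add.commute)
  qed
  moreover have "abs_convex s (A t)" if s: "s \<in> Q" for s
  proof -
    interpret s: sign_char s using Q s by blast
    have "A t = A s" using A_sub t s by blast
    moreover have "abs_convex s (A s)"
      unfolding abs_convex_def A_def using s.trans s.not_one by (smt (verit) mem_Collect_eq)
    ultimately show ?thesis by simp
  qed
  moreover have "agree_on_units t t' (A t)"
    unfolding agree_on_units_def
  proof (intro ballI impI, rule ccontr)
    \<comment> \<open>A unit at which t and t' differ has |u| <= 1 and |1 / u| <= 1, so u is 1 or
      -1, where all orderings agree.\<close>
    fix u assume u: "u \<in> A t" "u \<noteq> 0" "inverse u \<in> A t" and ne: "t u \<noteq> t' u"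
    have ne': "t (inverse u) \<noteq> t' (inverse u)"
      using ne u t.divide[of 1 u] t'.divide[of 1 u] by (simp add: inverse_eq_divide)
    have 1: "t (1 - u\<^sup>2) = 1" and "t (1 - (inverse u)\<^sup>2) = 1"
      using le_one[OF u(1,2) ne t(1) t(1)] le_one[OF u(3) _ ne' t(1) t(1)] u by auto
    moreover have "(1 - (inverse u)\<^sup>2) * u\<^sup>2 = - (1 - u\<^sup>2)"
      using u by (simp add: field_simps)
    ultimately have "t (- (1 - u\<^sup>2)) = 1" using t.mult_square[OF u(2)] by metis
    then have "u\<^sup>2 = 1" using t.minus[of "1 - u\<^sup>2"] 1 by force
    then have "u = 1 \<or> u = -1" by (simp add: power2_eq_1_iff)
    then show False using ne t.minus_one t'.minus_one by auto
  qed
  ultimately show ?thesis by blast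
qed


section \<open>Four-element fans\<close>

text \<open>The product of the four values at \<open>1 + x\<close> and at \<open>1 - x\<close> is \<open>1\<close>, and two of the four
  are known to be positive in each case.\<close>

lemma fan_same_size:
  assumes sc: "sign_char s1" "sign_char s2" "sign_char s3" "sign_char s4"
    and prod: "\<And>x. s1 x * s2 x = s3 x * s4 x"
    and x: "x \<noteq> 0" "s1 x = s2 x" "s1 x \<noteq> s3 x"
  shows "s1 (1 - x\<^sup>2) = s2 (1 - x\<^sup>2)"
proof -
  interpret s1: sign_char s1 by fact
  interpret s2: sign_char s2 by fact
  interpret s3: sign_char s3 by fact
  interpret s4: sign_char s4 by fact
  have main: "s1 (1 - x\<^sup>2) = s2 (1 - x\<^sup>2)"
    if x: "x \<noteq> 0" "s1 x = 1" "s2 x = 1" "s3 x = -1" "s4 x = -1" for x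
  proof -
    have n: "1 + x \<noteq> 0" "1 - x \<noteq> 0"
      using s1.add_pos[of 1 x] s3.add_pos[of 1 "- x"] s3.minus_neg[of x] x by auto
    have "s1 (1 + x) = 1" "s2 (1 + x) = 1"
      using s1.add[of 1 x] s2.add[of 1 x] x by auto
    moreover have "s3 (1 - x) = 1" "s4 (1 - x) = 1"
      using s3.add[of 1 "- x"] s4.add[of 1 "- x"] s3.minus_neg[of x] s4.minus_neg[of x] x by auto
    moreover have "s1 (1 - x) = s2 (1 - x)"
      using prod[of "1 - x"] calculation s1.cases[of "1 - x"] s2.cases[of "1 - x"] by auto
    ultimately have "s1 ((1 - x) * (1 + x)) = s2 ((1 - x) * (1 + x))"
      using s1.mult[of "1 - x" "1 + x"] s2.mult[of "1 - x" "1 + x"] n by simp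
    then show ?thesis by (simp add: power2_eq_square algebra_simps)
  qed
  have eq: "s3 x = s4 x" using prod[of x] x(2) s3.cases[of x] s4.cases[of x] by auto
  show ?thesis
  proof (cases "s1 x = 1")
    case True
    then show ?thesis using main[of x] x eq s3.cases[of x] by auto
  next
    case False
    then have "s1 (- x) = 1" "s2 (- x) = 1" "s3 (- x) = -1" "s4 (- x) = -1"
      using x eq s3.cases[of x] s1.minus[OF x(1)] s2.minus[OF x(1)] s3.minus[OF x(1)] s4.minus[OF x(1)]
      by auto
    then show ?thesis using main[of "- x"] x by simp
  qed
qed

text \<open>By hypothesis |x| and |y| lie on the same side of 1, and multiplication keeps |x y| on
  that side.\<close>

lemma (in sign_char) mult_size:
  assumes "s (1 - x\<^sup>2) = s (1 - y\<^sup>2)"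
  shows "s (1 - (x * y)\<^sup>2) = s (1 - x\<^sup>2)"
proof (cases "s (1 - x\<^sup>2) = 1")
  case True
  then have "s ((1 - x\<^sup>2) + x\<^sup>2 * (1 - y\<^sup>2)) = 1"
    using assms by (intro add mult_nonneg) auto
  then show ?thesis using True by (simp add: power_mult_distrib algebra_simps)
next
  case False
  then have "s (- (1 - x\<^sup>2)) = 1" and neg: "s (1 - y\<^sup>2) = -1" using assms minus_neg[of "1 - x\<^sup>2"] by auto
  then have "s (y\<^sup>2 * (- (1 - x\<^sup>2))) = 1" by (intro mult_nonneg) auto
  then have "s (- (1 - (x * y)\<^sup>2) + (1 - y\<^sup>2)) = 1" by (simp add: power_mult_distrib algebra_simps)
  then have "s (1 - (x * y)\<^sup>2) \<noteq> 1" using neg add[of "1 - (x * y)\<^sup>2"] by fastforce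
  then show ?thesis using False by auto
qed

text \<open>A pairing of a four-element fan can fail to be uniform only because of some \<open>y\<close> that is
  small for one pair of orderings and large for the other pair. Such elements cannot
  occur for two different pairings: the product of two of them would contradict
  \<open>fan_same_size\<close> for the third pairing.\<close>

lemma fan_no_two_exceptional:
  assumes sc: "sign_char s1" "sign_char s2" "sign_char s3" "sign_char s4"
    and prod: "\<And>x. s1 x * s2 x = s3 x * s4 x"
    and x: "x \<noteq> 0" "s1 x = s2 x" "s1 x \<noteq> s3 x" "s1 (1 - x\<^sup>2) \<noteq> s3 (1 - x\<^sup>2)"
    and y: "y \<noteq> 0" "s1 y = s3 y" "s1 y \<noteq> s2 y" "s1 (1 - y\<^sup>2) \<noteq> s2 (1 - y\<^sup>2)"
  shows False
proof -
  interpret s1: sign_char s1 by fact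
  interpret s2: sign_char s2 by fact
  interpret s3: sign_char s3 by fact
  interpret s4: sign_char s4 by fact
  have prod13: "s1 x * s3 x = s2 x * s4 x" and prod14: "s1 x * s4 x = s2 x * s3 x" for x
    using prod[of x] s1.cases[of x] s2.cases[of x] s3.cases[of x] s4.cases[of x] by auto
  have x4: "s3 x = s4 x" and y4: "s2 y = s4 y"
    using prod[of x] prod13[of y] x y s1.cases s2.cases s3.cases s4.cases
    by (metis mult_cancel_left s1.neq_zero s3.neq_zero mult.commute)+
  have ex: "s1 (1 - x\<^sup>2) = s2 (1 - x\<^sup>2)" "s3 (1 - x\<^sup>2) = s4 (1 - x\<^sup>2)"
    using fan_same_size[OF sc prod x(1,2,3)]
      fan_same_size[OF sc(3,4,1,2) prod[symmetric] x(1) x4 x(3)[symmetric]] by auto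
  have ey: "s1 (1 - y\<^sup>2) = s3 (1 - y\<^sup>2)" "s2 (1 - y\<^sup>2) = s4 (1 - y\<^sup>2)"
    using fan_same_size[OF sc(1,3,2,4) prod13 y(1,2,3)]
      fan_same_size[OF sc(2,4,1,3) prod13[symmetric] y(1) y4 y(3)[symmetric]] by auto
  have xy0: "x * y \<noteq> 0" using x y by simp
  have v: "s1 (x * y) = s1 x * s1 y" "s2 (x * y) = s2 x * s2 y"
    "s3 (x * y) = s3 x * s3 y" "s4 (x * y) = s4 x * s4 y"
    using x(1) y(1) by (simp_all add: s1.mult s2.mult s3.mult s4.mult)
  have xy: "s1 (x * y) = s4 (x * y)" "s2 (x * y) = s3 (x * y)" "s1 (x * y) \<noteq> s2 (x * y)"
    unfolding v using x(2,3) y(2,3) x4 y4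
      s1.cases[of x] s2.cases[of x] s3.cases[of x] s1.cases[of y] s2.cases[of y] s3.cases[of y]
    by auto
  have exy: "s1 (1 - (x * y)\<^sup>2) = s4 (1 - (x * y)\<^sup>2)" "s2 (1 - (x * y)\<^sup>2) = s3 (1 - (x * y)\<^sup>2)"
    using fan_same_size[OF sc(1,4,2,3) prod14 xy0 xy(1) xy(3)]
      fan_same_size[OF sc(2,3,1,4) prod14[symmetric] xy0 xy(2) xy(3)[symmetric]] by auto
  show False
  \<comment> \<open>Over s1, s2, s3, s4 the size of x has the pattern a, a, -a, -a and that of y the
    pattern b, -b, b, -b. If a = b, the product differs in size between s1 and s4; if a = -b,
    between s2 and s3.\<close>
  proof (cases "s1 (1 - x\<^sup>2) = s1 (1 - y\<^sup>2)")
    case True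
    then have "s4 (1 - x\<^sup>2) = s4 (1 - y\<^sup>2)"
      using ex ey x(4) y(4) s1.cases s2.cases s3.cases by metis
    then show False
      using exy ex x(4) s1.mult_size[OF True] s4.mult_size[of x y] by simp
  next
    case False
    then have "s2 (1 - x\<^sup>2) = s2 (1 - y\<^sup>2)" "s3 (1 - x\<^sup>2) = s3 (1 - y\<^sup>2)"
      using ex ey x(4) y(4) s1.cases s2.cases s3.cases by metis+
    then show False
      using exy ex x(4) s2.mult_size[of x y] s3.mult_size[of x y] by simp
  qed
qed

text \<open>An element separating s1 from s2 pairs s1 with s3 or with s4.
  \<open>fan_same_size\<close> gives equal sizes within each pair, and \<open>no13\<close> or
  \<open>no14\<close> links the two pairs.\<close>

lemma fan_uniform:
  assumes sc: "sign_char s1" "sign_char s2" "sign_char s3" "sign_char s4"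
    and prod: "\<And>x. s1 x * s2 x = s3 x * s4 x"
    and no13: "\<And>y. y \<noteq> 0 \<Longrightarrow> s1 y = s3 y \<Longrightarrow> s1 y \<noteq> s2 y \<Longrightarrow> s1 (1 - y\<^sup>2) = s2 (1 - y\<^sup>2)"
    and no14: "\<And>y. y \<noteq> 0 \<Longrightarrow> s1 y = s4 y \<Longrightarrow> s1 y \<noteq> s2 y \<Longrightarrow> s1 (1 - y\<^sup>2) = s2 (1 - y\<^sup>2)"
    and y: "y \<noteq> 0" "s1 y \<noteq> s2 y" and s: "s \<in> {s1, s2, s3, s4}"
  shows "s (1 - y\<^sup>2) = s1 (1 - y\<^sup>2)"
proof -
  interpret s1: sign_char s1 by fact
  interpret s2: sign_char s2 by fact
  interpret s3: sign_char s3 by fact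
  interpret s4: sign_char s4 by fact
  have prod13: "s1 x * s3 x = s2 x * s4 x" and prod14: "s1 x * s4 x = s2 x * s3 x" for x
    using prod[of x] s1.cases[of x] s2.cases[of x] s3.cases[of x] s4.cases[of x] by auto
  consider "s1 y = s3 y" "s2 y = s4 y" | "s1 y = s4 y" "s2 y = s3 y"
    using prod[of y] y(2) s1.cases[of y] s2.cases[of y] s3.cases[of y] s4.cases[of y] by auto
  then show ?thesis
  proof cases
    case 1
    then show ?thesis
      using fan_same_size[OF sc(1,3,2,4) prod13 y(1) 1(1) y(2)] no13[OF y(1) _ y(2)] s
        fan_same_size[OF sc(2,4,1,3) prod13[symmetric] y(1) 1(2) y(2)[symmetric]] by auto
  next
    case 2
    then show ?thesis
      using fan_same_size[OF sc(1,4,2,3) prod14 y(1) 2(1) y(2)] no14[OF y(1) _ y(2)] s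
        fan_same_size[OF sc(2,3,1,4) prod14[symmetric] y(1) 2(2) y(2)[symmetric]] by auto
  qed
qed

text \<open>The ring comes from \<open>convex_subring_of_uniform\<close>, applied to s1 and a
  suitable partner among s2, s3, s4.\<close>

lemma fan_convex_subring:
  assumes sc: "sign_char s1" "sign_char s2" "sign_char s3" "sign_char s4"
    and prod: "\<And>x. s1 x * s2 x = s3 x * s4 x"
    and distinct: "s1 \<noteq> s2" "s1 \<noteq> s3" "s1 \<noteq> s4"
  shows "\<exists>A. unital_subring A \<and> abs_convex s1 A \<and> abs_convex s2 A \<and>
    (\<exists>t. sign_char t \<and> s1 \<noteq> t \<and> agree_on_units s1 t A)"
proof -
  interpret s1: sign_char s1 by fact
  interpret s2: sign_char s2 by fact
  interpret s3: sign_char s3 by fact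
  interpret s4: sign_char s4 by fact
  let ?Q = "{s1, s2, s3, s4}"
  \<comment> \<open>\<open>exc t t'\<close> holds if some y groups s1 with t against t' and has
    different sizes for s1 and t'.\<close>
  define exc where "exc t t' \<longleftrightarrow> (\<exists>y. y \<noteq> 0 \<and> s1 y = t y \<and> s1 y \<noteq> t' y \<and> s1 (1 - y\<^sup>2) \<noteq> t' (1 - y\<^sup>2))"
    for t t' :: "'a \<Rightarrow> int"
  have prod13: "s1 x * s3 x = s2 x * s4 x" and prod14: "s1 x * s4 x = s2 x * s3 x" for x
    using prod[of x] s1.cases[of x] s2.cases[of x] s3.cases[of x] s4.cases[of x] by auto
  have result: ?thesis
    if t: "t \<in> ?Q" "s1 \<noteq> t"
      and u: "\<And>y s. y \<noteq> 0 \<Longrightarrow> s1 y \<noteq> t y \<Longrightarrow> s \<in> ?Q \<Longrightarrow> s (1 - y\<^sup>2) = s1 (1 - y\<^sup>2)" for t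
  proof -
    have Q: "sign_char s" if "s \<in> ?Q" for s using that sc by auto
    have "\<exists>A. unital_subring A \<and> (\<forall>s\<in>?Q. abs_convex s A) \<and> agree_on_units s1 t A"
    proof (rule convex_subring_of_uniform)
      show "s (1 - y\<^sup>2) = s' (1 - y\<^sup>2)"
        if "y \<noteq> 0" "s1 y \<noteq> t y" "s \<in> ?Q" "s' \<in> ?Q" for y s s'
        using u[OF that(1,2,3)] u[OF that(1,2,4)] by simp
    qed (use Q t in auto)
    then show ?thesis using t Q by blast
  qed
  have "\<not> (exc s2 s3 \<and> exc s3 s2)"
    using fan_no_two_exceptional[OF sc prod] unfolding exc_def by metis
  moreover have "\<not> (exc s2 s4 \<and> exc s4 s2)"
    using fan_no_two_exceptional[OF sc(1,2,4,3)] prod unfolding exc_def by (metis mult.commute)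
  moreover have "\<not> (exc s3 s4 \<and> exc s4 s3)"
    using fan_no_two_exceptional[OF sc(1,3,4,2)] prod13 unfolding exc_def by (metis mult.commute)
  \<comment> \<open>Either member of the opposite pair may serve as second argument, because
    \<open>fan_same_size\<close> gives both the same size.\<close>
  moreover have "exc s3 s4" if e: "exc s3 s2"
  proof -
    obtain y where y: "y \<noteq> 0" "s1 y = s3 y" "s1 y \<noteq> s2 y" "s1 (1 - y\<^sup>2) \<noteq> s2 (1 - y\<^sup>2)"
      using e by (auto simp: exc_def)
    have eq: "s2 y = s4 y"
      using prod13[of y] y(2) s2.cases[of y] s4.cases[of y] s3.cases[of y] by auto
    show ?thesis
      using y eq fan_same_size[OF sc(2,4,1,3) prod13[symmetric] y(1) eq y(3)[symmetric]]
      unfolding exc_def by metis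
  qed
  moreover have "exc s4 s3" if e: "exc s4 s2"
  proof -
    obtain y where y: "y \<noteq> 0" "s1 y = s4 y" "s1 y \<noteq> s2 y" "s1 (1 - y\<^sup>2) \<noteq> s2 (1 - y\<^sup>2)"
      using e by (auto simp: exc_def)
    have eq: "s2 y = s3 y"
      using prod14[of y] y(2) s2.cases[of y] s4.cases[of y] s3.cases[of y] by auto
    show ?thesis
      using y eq fan_same_size[OF sc(2,3,1,4) prod14[symmetric] y(1) eq y(3)[symmetric]]
      unfolding exc_def by metis
  qed
  \<comment> \<open>Two of the three pairings are free of exceptional elements. The partner t of s1
    is taken from the remaining one, because the y with \<open>s1 y \<noteq> t y\<close> realise
    just those two.\<close>
  ultimately consider "\<not> exc s3 s2" "\<not> exc s4 s2" | "\<not> exc s2 s3" "\<not> exc s4 s3" | "\<not> exc s2 s4" "\<not> exc s3 s4"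
    by blast
  then show ?thesis
  proof cases
    case 1
    have u: "s (1 - y\<^sup>2) = s1 (1 - y\<^sup>2)" if "y \<noteq> 0" "s1 y \<noteq> s2 y" "s \<in> ?Q" for y s
      by (rule fan_uniform[OF sc prod _ _ that]) (use 1 in \<open>auto simp: exc_def\<close>)
    show ?thesis
      by (rule result[of s2]) (use distinct u in auto)
  next
    case 2
    have u: "s (1 - y\<^sup>2) = s1 (1 - y\<^sup>2)" if "y \<noteq> 0" "s1 y \<noteq> s3 y" "s \<in> {s1, s3, s2, s4}" for y s
      by (rule fan_uniform[OF sc(1,3,2,4) prod13 _ _ that]) (use 2 in \<open>auto simp: exc_def\<close>)
    show ?thesis
      by (rule result[of s3]) (use distinct u in auto)
  next
    case 3
    have u: "s (1 - y\<^sup>2) = s1 (1 - y\<^sup>2)" if "y \<noteq> 0" "s1 y \<noteq> s4 y" "s \<in> {s1, s4, s2, s3}" for y s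
      by (rule fan_uniform[OF sc(1,4,2,3) prod14 _ _ that]) (use 3 in \<open>auto simp: exc_def\<close>)
    show ?thesis
      by (rule result[of s4]) (use distinct u in auto)
  qed
qed

section \<open>From simply connected pairs to the whole space\<close>

text \<open>Cancelling in s t = r r' shows that s differs from r and r', since the unordered pairs
  differ; so the four orderings form a fan.\<close>

lemma simply_connected_convex_subring:
  assumes X: "\<And>s. s \<in> X \<Longrightarrow> sign_char s" and st: "simply_connected X s t" "s \<noteq> t"
  shows "\<exists>A. unital_subring A \<and> abs_convex s A \<and> abs_convex t A \<and>
    (\<exists>t'. sign_char t' \<and> s \<noteq> t' \<and> agree_on_units s t' A)"
proof -
  obtain r r' where r: "s \<in> X" "t \<in> X" "r \<in> X" "r' \<in> X"
    and prod: "char_mult s t = char_mult r r'" and ne: "{s, t} \<noteq> {r, r'}"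
    using st(1) by (auto simp: simply_connected_def)
  have p: "s x * t x = r x * r' x" for x
    using fun_cong[OF prod, of x] by (simp add: char_mult_def)
  have nz: "u x \<noteq> 0" if "u \<in> X" for u x using sign_char.neq_zero[OF X[OF that]] .
  have "t = r'" if "s = r" using p nz[OF r(1)] that by (intro ext) auto
  moreover have "t = r" if "s = r'" using p nz[OF r(1)] that by (intro ext) (metis mult.commute mult_cancel_left)
  ultimately have "s \<noteq> r" "s \<noteq> r'" using ne by auto
  then show ?thesis using fan_convex_subring[of s t r r'] r X p st(2) by blast
qed

text \<open>Simple connectedness is symmetric, so a step in one direction covers the equivalence
  closure.\<close>

lemma connected_space_propagate:
  assumes "connected_space X" "s \<in> X" "t \<in> X" "P s"
    and step: "\<And>u v. simply_connected X u v \<Longrightarrow> u \<noteq> v \<Longrightarrow> P u \<Longrightarrow> P v"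
  shows "P t"
proof -
  have sym: "simply_connected X v u" if "simply_connected X u v" for u v
    using that by (auto simp: simply_connected_def char_mult_def mult.commute insert_commute)
  have "equivclp (simply_connected X) s t"
    using assms(1-3) by (auto simp: connected_space_def)
  then show ?thesis
    by (induction rule: equivclp_induct) (use assms(4) step sym in blast)+
qed

lemma connected_space_translation:
  fixes X :: "('a::field_char_0 \<Rightarrow> int) set"
  assumes X: "\<And>s. s \<in> X \<Longrightarrow> sign_char s" and fin: "finite X" and conn: "connected_space X"
    and two: "s0 \<in> X" "t0 \<in> X" "s0 \<noteq> t0"
  shows "\<exists>t t'. sign_char t \<and> sign_char t' \<and> t \<noteq> t' \<and>
    (\<forall>s\<in>X. sign_char (char_mult (char_mult t t') s))"
proof -
  define E where "E = {(s, t). simply_connected X s t \<and> s \<noteq> t}"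
  define good where "good = (\<lambda>(s :: 'a \<Rightarrow> int, t) A. unital_subring A \<and> abs_convex s A \<and> abs_convex t A \<and>
    (\<exists>t'. sign_char t' \<and> s \<noteq> t' \<and> agree_on_units s t' A))"
  have "\<forall>e\<in>E. \<exists>A. good e A"
    using simply_connected_convex_subring[OF X] unfolding E_def good_def by auto
  then obtain A where A: "\<And>e. e \<in> E \<Longrightarrow> good e (A e)" by metis
  have EX: "E \<subseteq> X \<times> X" by (auto simp: E_def simply_connected_def)
  \<comment> \<open>Without an edge between distinct orderings the class of s0 would be s0
    alone.\<close>
  have "E \<noteq> {}"
  proof
    assume "E = {}"
    then have "t0 = s0"
      using connected_space_propagate[OF conn two(1,2), of "\<lambda>u. u = s0"] by (auto simp: E_def)
    then show False using two by simp
  qed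
  moreover have "finite E" using EX fin finite_subset by blast
  ultimately have "\<exists>B\<in>A ` E. \<forall>C\<in>A ` E. B \<le> C \<longrightarrow> B = C"
    by (intro finite_has_maximal) auto
  then obtain B where B: "B \<in> A ` E" "\<And>C. C \<in> A ` E \<Longrightarrow> B \<subseteq> C \<Longrightarrow> B = C"
    by metis
  then obtain s t where st: "(s, t) \<in> E" "B = A (s, t)" by auto
  have g: "good (s, t) B" using A[OF st(1)] st(2) by simp
  then obtain t' where t': "sign_char t'" "s \<noteq> t'" "agree_on_units s t' B" and ring: "unital_subring B"
    by (auto simp: good_def)
  have conv: "abs_convex u B" if "u \<in> X" for u
  proof (rule connected_space_propagate[OF conn _ that])
    show "s \<in> X" using st EX by auto
    show "abs_convex s B" using g by (simp add: good_def)
    fix u v assume uv: "simply_connected X u v" "u \<noteq> v" and u: "abs_convex u B"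
    then have e: "(u, v) \<in> E" by (simp add: E_def)
    have h: "good (u, v) (A (u, v))" by (rule A[OF e])
    have "u \<in> X" "v \<in> X" using e EX by auto
    \<comment> \<open>A (u, v) and B are both convex for u, hence comparable, and maximality of B
      leaves only A (u, v) inside B. So B is an overring of a ring convex for v.\<close>
    then have "A (u, v) \<subseteq> B"
      using abs_convex_chain[OF X u, of "A (u, v)"] h B(2)[of "A (u, v)"] e by (auto simp: good_def)
    then show "abs_convex v B"
      using abs_convex_overring[OF X[OF \<open>v \<in> X\<close>], of "A (u, v)" B] h ring by (simp add: good_def)
  qed
  have "s \<in> X" using st EX by auto
  then show ?thesis
    using sign_char_twist[OF X X[OF \<open>s \<in> X\<close>] t'(1) ring conv t'(3)] X t' by blast
qed

text \<open>Turns the hypothesis on the rank into a second ordering. Dimension 0 is impossible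
  because the empty set spans only the character 1, whereas \<open>s (-1) = -1\<close>.\<close>

lemma rank_chars_singleton:
  assumes "sign_char s"
  shows "rank_chars {s} = 1"
  unfolding rank_chars_def
proof (rule Least_equality)
  have "s \<in> char_span {s}" using char_span.mult[OF char_span.one, of s "{s}"] by (simp add: char_mult_def)
  then show "\<exists>S. finite S \<and> card S = 1 \<and> S \<subseteq> char_span {s} \<and> char_span S = char_span {s}"
    by (intro exI[of _ "{s}"]) simp
  fix n
  assume "\<exists>S. finite S \<and> card S = n \<and> S \<subseteq> char_span {s} \<and> char_span S = char_span {s}"
  then obtain S where S: "finite S" "card S = n" "char_span S = char_span {s}" by blast
  have "n \<noteq> 0"
  proof
    assume "n = 0"
    then have "s \<in> char_span {}" using S \<open>s \<in> char_span {s}\<close> by simp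
    then have "s = (\<lambda>_. 1)" by (cases rule: char_span.cases) auto
    then show False using sign_char.minus_one[OF assms] by simp
  qed
  then show "1 \<le> n" by simp
qed

section \<open>Extending automorphisms to \<open>F\<^sup>(\<^sup>3\<^sup>)\<close>\<close>

lemma is_subfieldD:
  assumes "is_subfield K"
  shows "0 \<in> K" "1 \<in> K" "x \<in> K \<Longrightarrow> y \<in> K \<Longrightarrow> x + y \<in> K" "x \<in> K \<Longrightarrow> y \<in> K \<Longrightarrow> x * y \<in> K"
    "x \<in> K \<Longrightarrow> - x \<in> K" "x \<in> K \<Longrightarrow> inverse x \<in> K"
  using assms by (auto simp: is_subfield_def)

lemma is_subfield_field_gen: "is_subfield (field_gen S)"
  unfolding field_gen_def is_subfield_def by blast

lemma field_gen_superset: "S \<subseteq> field_gen S"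
  unfolding field_gen_def by blast

lemma field_gen_least: "is_subfield K \<Longrightarrow> S \<subseteq> K \<Longrightarrow> field_gen S \<subseteq> K"
  unfolding field_gen_def by blast

section \<open>Partial embeddings and their extension by square roots\<close>

text \<open>Partial embeddings of a field into itself are represented by their graphs, which makes
  unions of chains immediate.\<close>

definition embedding_graph :: "('b::field \<times> 'b) set \<Rightarrow> bool" where
  "embedding_graph R \<longleftrightarrow> (0, 0) \<in> R \<and> (1, 1) \<in> R \<and>
    (\<forall>x x' y y'. (x, x') \<in> R \<longrightarrow> (y, y') \<in> R \<longrightarrow> (x + y, x' + y') \<in> R \<and> (x * y, x' * y') \<in> R) \<and>
    (\<forall>x x'. (x, x') \<in> R \<longrightarrow>
      (- x, - x') \<in> R \<and> (inverse x, inverse x') \<in> R \<and> (x = 0 \<longleftrightarrow> x' = 0))"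

lemma embedding_graphD:
  assumes "embedding_graph R"
  shows "(0, 0) \<in> R" "(1, 1) \<in> R"
    "(x, x') \<in> R \<Longrightarrow> (y, y') \<in> R \<Longrightarrow> (x + y, x' + y') \<in> R"
    "(x, x') \<in> R \<Longrightarrow> (y, y') \<in> R \<Longrightarrow> (x * y, x' * y') \<in> R"
    "(x, x') \<in> R \<Longrightarrow> (y, y') \<in> R \<Longrightarrow> (x - y, x' - y') \<in> R"
    "(x, x') \<in> R \<Longrightarrow> (- x, - x') \<in> R"
    "(x, x') \<in> R \<Longrightarrow> (inverse x, inverse x') \<in> R"
    "(x, x') \<in> R \<Longrightarrow> x = 0 \<longleftrightarrow> x' = 0"
proof -
  show "(0, 0) \<in> R" "(1, 1) \<in> R"
    and add: "(x, x') \<in> R \<Longrightarrow> (y, y') \<in> R \<Longrightarrow> (x + y, x' + y') \<in> R"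
    and "(x, x') \<in> R \<Longrightarrow> (y, y') \<in> R \<Longrightarrow> (x * y, x' * y') \<in> R"
    and minus: "(x, x') \<in> R \<Longrightarrow> (- x, - x') \<in> R"
    and "(x, x') \<in> R \<Longrightarrow> (inverse x, inverse x') \<in> R"
    and "(x, x') \<in> R \<Longrightarrow> x = 0 \<longleftrightarrow> x' = 0" for x x' y y'
    using assms unfolding embedding_graph_def by blast+
  show "(x - y, x' - y') \<in> R" if "(x, x') \<in> R" "(y, y') \<in> R"
    using add[OF that(1) minus[OF that(2)]] by simp
qed

text \<open>The condition on zeros, applied to differences, makes R single-valued and injective at
  once.\<close>

lemma embedding_graph_eq_iff:
  assumes "embedding_graph R" "(x, x') \<in> R" "(y, y') \<in> R"
  shows "x = y \<longleftrightarrow> x' = y'"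
  using embedding_graphD(8)[OF assms(1) embedding_graphD(5)[OF assms]] by simp

lemma is_subfield_Domain:
  assumes "embedding_graph R"
  shows "is_subfield (Domain R)"
  unfolding is_subfield_def
proof (intro conjI ballI)
  note D = embedding_graphD[OF assms]
  show "0 \<in> Domain R" "1 \<in> Domain R" using D(1,2) by blast+
  fix x assume "x \<in> Domain R"
  then obtain x' where x: "(x, x') \<in> R" by (rule DomainE)
  show "- x \<in> Domain R" "inverse x \<in> Domain R" using D(6,7)[OF x] by blast+
  fix y assume "y \<in> Domain R"
  then obtain y' where y: "(y, y') \<in> R" by (rule DomainE)
  show "x + y \<in> Domain R" "x * y \<in> Domain R" using D(3,4)[OF x y] by blast+
qed

text \<open>The extension of R sending r to s. It is used for r outside the domain with r^2
  corresponding to s^2, where a + b r determines a and b.\<close>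

definition adjoin_root :: "('b::field \<times> 'b) set \<Rightarrow> 'b \<Rightarrow> 'b \<Rightarrow> ('b \<times> 'b) set" where
  "adjoin_root R r s = {(a + b * r, a' + b' * s) | a a' b b'. (a, a') \<in> R \<and> (b, b') \<in> R}"

lemma adjoin_rootI: "(a, a') \<in> R \<Longrightarrow> (b, b') \<in> R \<Longrightarrow> (a + b * r, a' + b' * s) \<in> adjoin_root R r s"
  unfolding adjoin_root_def by blast

lemma adjoin_root_superset:
  assumes "embedding_graph R"
  shows "R \<subseteq> adjoin_root R r s" "(r, s) \<in> adjoin_root R r s"
proof -
  note D = embedding_graphD[OF assms]
  show "R \<subseteq> adjoin_root R r s"
    using adjoin_rootI[OF _ D(1), of _ _ r s] by auto
  show "(r, s) \<in> adjoin_root R r s"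
    using adjoin_rootI[OF D(1,2), of r s] by simp
qed

text \<open>With \<open>b \<noteq> 0\<close> the field \<open>Domain R\<close> would contain r = - a
  / b. So 1 and r are independent over it.\<close>

lemma Domain_mult_root:
  assumes "embedding_graph R" "r \<notin> Domain R" "a \<in> Domain R" "b \<in> Domain R" "a + b * r = 0"
  shows "b = 0"
proof (rule ccontr)
  assume "b \<noteq> 0"
  then have "r = - a * inverse b" using assms(5) by (simp add: field_simps eq_neg_iff_add_eq_0 add.commute)
  moreover have "- a * inverse b \<in> Domain R"
    using is_subfield_Domain[OF assms(1)] assms(3,4) by (auto simp: is_subfield_def)
  ultimately show False using assms(2) by simp
qed

text \<open>Zeros transfer through the norm: if a' + b' s = 0, its norm vanishes, hence so does the
  corresponding norm a^2 - b^2 r^2, and r outside the domain forces a = b = 0.\<close>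

lemma embedding_graph_adjoin_root:
  assumes R: "embedding_graph R" and r: "r \<notin> Domain R" and d: "(r\<^sup>2, s\<^sup>2) \<in> R"
  shows "embedding_graph (adjoin_root R r s)"
proof -
  note D = embedding_graphD[OF R]
  let ?R = "adjoin_root R r s"
  have zero: "a + b * r = 0 \<longleftrightarrow> a' + b' * s = 0"
    and norm: "a\<^sup>2 - b\<^sup>2 * r\<^sup>2 = 0 \<longleftrightarrow> a + b * r = 0"
    and norm': "a'\<^sup>2 - b'\<^sup>2 * s\<^sup>2 = 0 \<longleftrightarrow> a' + b' * s = 0"
    and nR: "(a\<^sup>2 - b\<^sup>2 * r\<^sup>2, a'\<^sup>2 - b'\<^sup>2 * s\<^sup>2) \<in> R"
    if ab: "(a, a') \<in> R" "(b, b') \<in> R" for a a' b b'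
  proof -
    have f: "a\<^sup>2 - b\<^sup>2 * r\<^sup>2 = (a + b * r) * (a - b * r)" "a'\<^sup>2 - b'\<^sup>2 * s\<^sup>2 = (a' + b' * s) * (a' - b' * s)"
      by (simp_all add: power2_eq_square algebra_simps)
    show nR: "(a\<^sup>2 - b\<^sup>2 * r\<^sup>2, a'\<^sup>2 - b'\<^sup>2 * s\<^sup>2) \<in> R"
      using D(5)[OF D(4)[OF ab(1,1)] D(4)[OF D(4)[OF ab(2,2)] d]] by (simp add: power2_eq_square)
    have dom: "a \<in> Domain R" "b \<in> Domain R" "- b \<in> Domain R" using ab D(6) by auto
    have b0: "b = 0" "a = 0" if "a\<^sup>2 - b\<^sup>2 * r\<^sup>2 = 0"
    proof -
      have "a + b * r = 0 \<or> a + (- b) * r = 0" using that f by simp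
      then show "b = 0" using Domain_mult_root[OF R r dom(1,2)] Domain_mult_root[OF R r dom(1,3)] by auto
      then show "a = 0" using that by simp
    qed
    show n: "a\<^sup>2 - b\<^sup>2 * r\<^sup>2 = 0 \<longleftrightarrow> a + b * r = 0" using b0 f by auto
    have "a' = 0 \<and> b' = 0" if "a\<^sup>2 - b\<^sup>2 * r\<^sup>2 = 0" using b0[OF that] D(8) ab by blast
    moreover have "a'\<^sup>2 - b'\<^sup>2 * s\<^sup>2 = 0 \<longleftrightarrow> a\<^sup>2 - b\<^sup>2 * r\<^sup>2 = 0" using D(8)[OF nR] by simp
    moreover have "a' + b' * s = 0 \<Longrightarrow> a'\<^sup>2 - b'\<^sup>2 * s\<^sup>2 = 0" using f(2) by simp
    moreover have "a' = 0 \<and> b' = 0 \<Longrightarrow> a' + b' * s = 0" by simp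
    ultimately show "a'\<^sup>2 - b'\<^sup>2 * s\<^sup>2 = 0 \<longleftrightarrow> a' + b' * s = 0" "a + b * r = 0 \<longleftrightarrow> a' + b' * s = 0"
      using n by metis+
  qed
  have "(x + y, x' + y') \<in> ?R \<and> (x * y, x' * y') \<in> ?R" if xy: "(x, x') \<in> ?R" "(y, y') \<in> ?R" for x x' y y'
  proof -
    obtain a a' b b' where x: "x = a + b * r" "x' = a' + b' * s" "(a, a') \<in> R" "(b, b') \<in> R"
      using xy(1) by (auto simp: adjoin_root_def)
    obtain c c' e e' where y: "y = c + e * r" "y' = c' + e' * s" "(c, c') \<in> R" "(e, e') \<in> R"
      using xy(2) by (auto simp: adjoin_root_def)
    have 1: "((a + c) + (b + e) * r, (a' + c') + (b' + e') * s) \<in> ?R"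
      using x y by (intro adjoin_rootI D)
    have 2: "((a * c + b * e * r\<^sup>2) + (a * e + b * c) * r, (a' * c' + b' * e' * s\<^sup>2) + (a' * e' + b' * c') * s) \<in> ?R"
      using x y d by (intro adjoin_rootI D)
    show ?thesis using 1 2 unfolding x(1,2) y(1,2) by (simp add: power2_eq_square algebra_simps)
  qed
  moreover have "(- x, - x') \<in> ?R \<and> (inverse x, inverse x') \<in> ?R \<and> (x = 0 \<longleftrightarrow> x' = 0)"
    if xx: "(x, x') \<in> ?R" for x x'
  proof -
    obtain a a' b b' where x: "x = a + b * r" "x' = a' + b' * s" "(a, a') \<in> R" "(b, b') \<in> R"
      using xx by (auto simp: adjoin_root_def)
    have 1: "(- a + (- b) * r, - a' + (- b') * s) \<in> ?R" using x by (intro adjoin_rootI D)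
    define N N' where "N = a\<^sup>2 - b\<^sup>2 * r\<^sup>2" and "N' = a'\<^sup>2 - b'\<^sup>2 * s\<^sup>2"
    have 2: "(a * inverse N + (- b * inverse N) * r, a' * inverse N' + (- b' * inverse N') * s) \<in> ?R"
      unfolding N_def N'_def by (intro adjoin_rootI D(4,6,7) nR x(3,4))
    \<comment> \<open>The inverse is the conjugate divided by the norm; for the zero element both
      sides are 0 because \<open>inverse 0 = 0\<close>.\<close>
    have inv: "c * inverse M + (- e * inverse M) * q = inverse (c + e * q)"
      if "M = c\<^sup>2 - e\<^sup>2 * q\<^sup>2" "M = 0 \<longleftrightarrow> c + e * q = 0" for c e q M :: 'a
    proof (cases "M = 0")
      case False
      have "M = (c + e * q) * (c - e * q)" using that(1) by (simp add: power2_eq_square algebra_simps)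
      then have "(c + e * q) * ((c - e * q) * inverse M) = 1"
        using False by (metis mult.assoc right_inverse)
      then have "inverse (c + e * q) = (c - e * q) * inverse M" by (rule inverse_unique)
      then show ?thesis by (simp add: algebra_simps)
    qed (use that in simp)
    have "a * inverse N + (- b * inverse N) * r = inverse x" "a' * inverse N' + (- b' * inverse N') * s = inverse x'"
      unfolding x N_def N'_def by (rule inv, rule refl, rule norm norm', rule x, rule x)+
    then show ?thesis using 1 2 zero[OF x(3,4)] unfolding x(1,2) by auto
  qed
  ultimately show ?thesis
    using adjoin_root_superset(1)[OF R, of r s] D(1,2) unfolding embedding_graph_def by blast
qed

section \<open>Realising a quadratic character on square roots\<close>

locale kummer_character =
  fixes i :: "'a::field_char_0 \<Rightarrow> 'b::field" and \<chi> :: "'a \<Rightarrow> int"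
  assumes emb: "field_embedding i" and closed: "alg_closed TYPE('b)"
    and chi_cases: "\<chi> a = 1 \<or> \<chi> a = -1"
    and chi_mult: "a \<noteq> 0 \<Longrightarrow> b \<noteq> 0 \<Longrightarrow> \<chi> (a * b) = \<chi> a * \<chi> b"
begin

lemma i_add: "i (x + y) = i x + i y" and i_mult: "i (x * y) = i x * i y" and i_one [simp]: "i 1 = 1"
  and i_eq_iff [simp]: "i x = i y \<longleftrightarrow> x = y"
  using emb by (auto simp: field_embedding_def inj_def)

lemma i_zero [simp]: "i 0 = 0"
  using i_add[of 0 0] by (metis add.right_neutral add_left_cancel)

lemma i_eq_zero_iff [simp]: "i x = 0 \<longleftrightarrow> x = 0"
  using i_eq_iff[of x 0] by simp

lemma i_minus: "i (- x) = - i x"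
  by (rule minus_unique[symmetric]) (simp flip: i_add)

lemma i_inverse: "i (inverse x) = inverse (i x)"
proof (cases "x = 0")
  case False
  then have "i x * i (inverse x) = 1" by (simp flip: i_mult)
  then show ?thesis using inverse_unique by metis
qed simp

lemma two_neq_zero: "(2::'b) \<noteq> 0"
  using i_eq_zero_iff[of 2] i_add[of 1 1] by (metis i_one one_add_one zero_neq_numeral)

lemma ex_sqrt: "\<exists>r::'b. r\<^sup>2 = c"
proof -
  have "\<exists>x::'b. poly [:- c, 0, 1:] x = 0"
    using closed[unfolded alg_closed_def, rule_format, of "[:- c, 0, 1:]"] by simp
  then show ?thesis by (auto simp: power2_eq_square)
qed

text \<open>The twist is required only of square roots inside the domain, so the base field is a
  possible start and the condition passes to unions of chains.\<close>

definition twisted_embedding :: "('b \<times> 'b) set \<Rightarrow> bool" where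
  "twisted_embedding R \<longleftrightarrow> embedding_graph R \<and> (\<forall>a. (i a, i a) \<in> R) \<and>
    (\<forall>a y y'. a \<noteq> 0 \<longrightarrow> y\<^sup>2 = i a \<longrightarrow> (y, y') \<in> R \<longrightarrow> y' = of_int (\<chi> a) * y)"

lemma chi_square: "a \<noteq> 0 \<Longrightarrow> \<chi> (a * a) = 1"
  using chi_cases[of a] by (auto simp: chi_mult)

lemma twisted_embedding_range: "twisted_embedding (range (\<lambda>a. (i a, i a)))"
  unfolding twisted_embedding_def embedding_graph_def
proof (intro conjI allI impI; (elim rangeE)?)
  show "(0, 0) \<in> range (\<lambda>a. (i a, i a))" "(1, 1) \<in> range (\<lambda>a. (i a, i a))"
    by (auto intro: range_eqI[of _ _ 0] range_eqI[of _ _ 1])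
  fix x x' y y' a b
  assume "(x, x') = (i a, i a)" "(y, y') = (i b, i b)"
  then show "(x + y, x' + y') \<in> range (\<lambda>a. (i a, i a))" "(x * y, x' * y') \<in> range (\<lambda>a. (i a, i a))"
    by (auto simp flip: i_add i_mult)
next
  fix x x' a assume x: "(x, x') = (i a, i a)"
  then show "(- x, - x') \<in> range (\<lambda>a. (i a, i a))" "(inverse x, inverse x') \<in> range (\<lambda>a. (i a, i a))"
    by (auto simp flip: i_minus i_inverse)
  show "(x = 0) = (x' = 0)" using x by simp
next
  \<comment> \<open>A square root lying in F makes a square of a, where the character is 1.\<close>
  fix a y y' b assume a: "a \<noteq> 0" "y\<^sup>2 = i a" and y: "(y, y') = (i b, i b)"
  then have "a = b * b" by (simp add: power2_eq_square flip: i_mult)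
  then show "y' = of_int (\<chi> a) * y" using y a chi_square[of b] by simp
qed simp

lemma ex_maximal_twisted_embedding:
  "\<exists>R. twisted_embedding R \<and> (\<forall>S. twisted_embedding S \<longrightarrow> R \<subseteq> S \<longrightarrow> S = R)"
proof -
  have "\<exists>M\<in>Collect twisted_embedding. \<forall>X\<in>Collect twisted_embedding. M \<subseteq> X \<longrightarrow> X = M"
  proof (rule subset_Zorn_nonempty)
    show "Collect twisted_embedding \<noteq> {}" using twisted_embedding_range by blast
    fix C assume C: "C \<noteq> {}" "subset.chain (Collect twisted_embedding) C"
    have T: "twisted_embedding R" if "R \<in> C" for R
      using C(2) that by (auto simp: subset.chain_def)
    \<comment> \<open>Two pairs from the union lie in a common member of the chain, whose closure
      laws then apply.\<close>
    have two: "\<exists>R\<in>C. p \<in> R \<and> q \<in> R" if "p \<in> \<Union>C" "q \<in> \<Union>C" for p q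
    proof -
      obtain R S where RS: "p \<in> R" "R \<in> C" "q \<in> S" "S \<in> C" using \<open>p \<in> \<Union>C\<close> \<open>q \<in> \<Union>C\<close> by blast
      then have "R \<subseteq> S \<or> S \<subseteq> R" using C(2) by (auto simp: subset_chain_def)
      then show ?thesis using RS by blast
    qed
    have "embedding_graph (\<Union>C)"
      unfolding embedding_graph_def
    proof (intro conjI allI impI)
      show "(0, 0) \<in> \<Union>C" "(1, 1) \<in> \<Union>C"
        using C(1) T embedding_graphD(1,2) unfolding twisted_embedding_def by blast+
    next
      fix x x' y y' assume "(x, x') \<in> \<Union>C" "(y, y') \<in> \<Union>C"
      from two[OF this] show "(x + y, x' + y') \<in> \<Union>C" "(x * y, x' * y') \<in> \<Union>C"
        using T embedding_graphD(3,4) unfolding twisted_embedding_def by blast+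
    next
      fix x x' assume "(x, x') \<in> \<Union>C"
      then show "(- x, - x') \<in> \<Union>C" "(inverse x, inverse x') \<in> \<Union>C" "(x = 0) = (x' = 0)"
        using T embedding_graphD(6,7,8) unfolding twisted_embedding_def by blast+
    qed
    then show "\<Union>C \<in> Collect twisted_embedding"
      using T C(1) unfolding twisted_embedding_def by blast
  qed
  then show ?thesis by blast
qed

text \<open>Otherwise r could be sent to \<chi>(b) r. The twist survives: if a + c r is a square
  root of i e, comparing coefficients gives 2 a c = 0, so the root is an old one or is c r with c^2
  = i (e / b), and \<chi>(e / b) \<chi>(b) = \<chi>(e).\<close>

lemma maximal_contains_sqrt_of_base:
  assumes R: "twisted_embedding R" and max: "\<And>S. twisted_embedding S \<Longrightarrow> R \<subseteq> S \<Longrightarrow> S = R"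
    and b: "b \<noteq> 0" and r: "r\<^sup>2 = i b"
  shows "r \<in> Domain R"
proof (rule ccontr)
  assume nr: "r \<notin> Domain R"
  have G: "embedding_graph R" and base: "(i a, i a) \<in> R" for a
    using R by (auto simp: twisted_embedding_def)
  have tw: "y' = of_int (\<chi> a) * y" if "a \<noteq> 0" "y\<^sup>2 = i a" "(y, y') \<in> R" for a y y'
    using R that by (auto simp: twisted_embedding_def)
  note D = embedding_graphD[OF G]
  define s where "s = of_int (\<chi> b) * r"
  have "s\<^sup>2 = r\<^sup>2" using chi_cases[of b] by (auto simp: s_def power_mult_distrib)
  then have d: "(r\<^sup>2, s\<^sup>2) \<in> R" using r base by simp
  have r0: "r \<noteq> 0" using r b by auto
  have "y' = of_int (\<chi> e) * y"
    if e: "e \<noteq> 0" "y\<^sup>2 = i e" and y: "(y, y') \<in> adjoin_root R r s" for e y y'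
  proof -
    obtain a a' c c' where ac: "y = a + c * r" "y' = a' + c' * s" "(a, a') \<in> R" "(c, c') \<in> R"
      using y by (auto simp: adjoin_root_def)
    have "i e = a\<^sup>2 + c\<^sup>2 * r\<^sup>2 + (2 * a * c) * r"
      using e(2) unfolding ac by (simp add: power2_eq_square algebra_simps)
    then have "(a\<^sup>2 + c\<^sup>2 * r\<^sup>2 - i e) + (2 * a * c) * r = 0" by simp
    moreover have "(a * a + (c * c) * r\<^sup>2 - i e, a' * a' + (c' * c') * s\<^sup>2 - i e) \<in> R"
      using ac d base by (intro D(3-5))
    then have "a\<^sup>2 + c\<^sup>2 * r\<^sup>2 - i e \<in> Domain R" by (auto simp: power2_eq_square)
    moreover have "((1 + 1) * a * c, (1 + 1) * a' * c') \<in> R" using ac by (intro D(2-4))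
    then have "2 * a * c \<in> Domain R" by auto
    ultimately have "2 * a * c = 0" using Domain_mult_root[OF G nr] by blast
    then consider "c = 0" | "a = 0" using two_neq_zero by auto
    then show ?thesis
    proof cases
      case 1
      then have "c' = 0" using D(8) ac by blast
      then show ?thesis using 1 ac tw[OF e(1), of a a'] e by simp
    next
      case 2
      then have a': "a' = 0" using D(8) ac by blast
      have "c\<^sup>2 * i b = i e" using e(2) r unfolding ac 2 by (simp add: power_mult_distrib)
      moreover have "i (e * inverse b) * i b = i e" using b by (simp flip: i_mult)
      ultimately have "c\<^sup>2 = i (e * inverse b)" using b by (metis i_eq_zero_iff mult_right_cancel)
      then have c': "c' = of_int (\<chi> (e * inverse b)) * c"
        using tw[of "e * inverse b" c c'] e b ac by simp
      have "\<chi> (e * inverse b) * \<chi> b = \<chi> e"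
        using chi_mult[of "e * inverse b" b] e b by (simp add: mult.assoc)
      then have "of_int (\<chi> (e * inverse b)) * of_int (\<chi> b) = (of_int (\<chi> e) :: 'b)"
        by (metis of_int_mult)
      then show ?thesis
        unfolding ac 2 a' c' s_def by (simp add: mult_ac)
    qed
  qed
  then have "twisted_embedding (adjoin_root R r s)"
    using embedding_graph_adjoin_root[OF G nr d] base adjoin_root_superset(1)[OF G, of r s]
    unfolding twisted_embedding_def by blast
  then have "adjoin_root R r s = R" using max adjoin_root_superset(1)[OF G] by blast
  then show False using adjoin_root_superset(2)[OF G, of r s] nr by auto
qed

text \<open>All square roots of base elements are in the domain already, so sending r to any square
  root of the image of r^2 cannot violate the twist.\<close>

lemma maximal_closed_under_sqrt:
  assumes R: "twisted_embedding R" and max: "\<And>S. twisted_embedding S \<Longrightarrow> R \<subseteq> S \<Longrightarrow> S = R"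
    and r: "r\<^sup>2 \<in> Domain R"
  shows "r \<in> Domain R"
proof (rule ccontr)
  assume nr: "r \<notin> Domain R"
  have G: "embedding_graph R" using R by (auto simp: twisted_embedding_def)
  obtain d' where d': "(r\<^sup>2, d') \<in> R" using r by blast
  obtain s where s: "s\<^sup>2 = d'" using ex_sqrt by blast
  have G': "embedding_graph (adjoin_root R r s)" using embedding_graph_adjoin_root[OF G nr] d' s by simp
  have sup: "R \<subseteq> adjoin_root R r s" "(r, s) \<in> adjoin_root R r s" by (rule adjoin_root_superset[OF G])+
  have "y' = of_int (\<chi> a) * y"
    if a: "a \<noteq> 0" "y\<^sup>2 = i a" and y: "(y, y') \<in> adjoin_root R r s" for a y y'
  proof -
    obtain z where z: "(y, z) \<in> R" using maximal_contains_sqrt_of_base[OF R max a] by blast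
    then have "y' = z" using embedding_graph_eq_iff[OF G' y, of y z] sup by auto
    then show ?thesis using R a z by (auto simp: twisted_embedding_def)
  qed
  then have "twisted_embedding (adjoin_root R r s)"
    using R G' sup unfolding twisted_embedding_def by blast
  then have "adjoin_root R r s = R" using max sup by blast
  then show False using sup nr by auto
qed

end

section \<open>Quadratic and Galois extensions\<close>

text \<open>Cayley-Hamilton: multiplication by x acts on the generators u, v of K by a 2 by 2 matrix
  over E, with trace p and determinant q.\<close>

lemma quadratic_ext_root:
  assumes "quadratic_ext E K" "is_subfield E" "x \<in> K"
  shows "\<exists>p\<in>E. \<exists>q\<in>E. x\<^sup>2 - p * x + q = 0"
proof -
  obtain u v where uv: "u \<in> K" "v \<in> K"
    and ex1: "\<forall>x\<in>K. \<exists>!ab. fst ab \<in> E \<and> snd ab \<in> E \<and> x = fst ab * u + snd ab * v"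
    using assms(1) unfolding quadratic_ext_def by blast
  have ex: "\<exists>a b. a \<in> E \<and> b \<in> E \<and> x = a * u + b * v" if "x \<in> K" for x
    using ex1_implies_ex[OF bspec[OF ex1 that]] by auto
  have K: "is_subfield K" using assms(1) by (simp add: quadratic_ext_def)
  have "x * u \<in> K" "x * v \<in> K" "1 \<in> K"
    using K uv assms(3) by (auto simp: is_subfield_def)
  then obtain a b c d e f where E: "a \<in> E" "b \<in> E" "c \<in> E" "d \<in> E"
    and eq: "x * u = a * u + b * v" "x * v = c * u + d * v" and one: "1 = e * u + f * v"
    using ex by meson
  let ?D = "x\<^sup>2 - (a + d) * x + (a * d - b * c)"
  have 1: "?D * u = (x - d) * (x * u - a * u - b * v) + b * (x * v - c * u - d * v)"
    by (simp add: power2_eq_square algebra_simps)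
  have 2: "?D * v = (x - a) * (x * v - c * u - d * v) + c * (x * u - a * u - b * v)"
    by (simp add: power2_eq_square algebra_simps)
  have "?D * u = 0" "?D * v = 0" unfolding 1 2 by (simp_all add: eq)
  moreover have "u \<noteq> 0 \<or> v \<noteq> 0" using one by auto
  ultimately have "?D = 0" by auto
  moreover have "a + d \<in> E" "a * d - b * c \<in> E"
    using E assms(2) unfolding is_subfield_def diff_conv_add_uminus by blast+
  ultimately show ?thesis by blast
qed

definition hom_on :: "'b::field set \<Rightarrow> ('b \<Rightarrow> 'b) \<Rightarrow> bool" where
  "hom_on K h \<longleftrightarrow> (\<forall>x\<in>K. \<forall>y\<in>K. h (x + y) = h x + h y \<and> h (x * y) = h x * h y)"

lemma coeff_linear_mult:
  fixes y :: "'b::field"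
  shows "coeff ([:- y, 1:] * p) n = - y * coeff p n + (if n = 0 then 0 else coeff p (n - 1))"
  by (cases n) auto

text \<open>Each new factor combines coefficients by sums and products, which h respects. Membership
  in K is carried along in the induction because h is a homomorphism only there.\<close>

lemma hom_on_coeff_prod_roots:
  assumes K: "is_subfield K" and h: "hom_on K h" "h 1 = 1"
    and S: "finite S" "S \<subseteq> K"
  shows "coeff (\<Prod>y\<in>S. [:- y, 1:]) n \<in> K \<and>
    coeff (\<Prod>y\<in>S. [:- h y, 1:]) n = h (coeff (\<Prod>y\<in>S. [:- y, 1:]) n)"
  using S
proof (induction S arbitrary: n rule: finite_induct)
  case empty
  have "h 0 = 0" using h K by (metis add_cancel_right_left hom_on_def is_subfield_def)
  then show ?case using K h by (simp add: is_subfield_def)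
next
  case (insert z S)
  have cl: "0 \<in> K" "x \<in> K \<Longrightarrow> y \<in> K \<Longrightarrow> x + y \<in> K" "x \<in> K \<Longrightarrow> y \<in> K \<Longrightarrow> x * y \<in> K" "x \<in> K \<Longrightarrow> - x \<in> K" for x y
    using K by (auto simp: is_subfield_def)
  have hh: "x \<in> K \<Longrightarrow> y \<in> K \<Longrightarrow> h (x + y) = h x + h y" "x \<in> K \<Longrightarrow> y \<in> K \<Longrightarrow> h (x * y) = h x * h y" for x y
    using h by (auto simp: hom_on_def)
  have h0: "h 0 = 0" using hh(1)[OF cl(1,1)] by (metis add.right_neutral add_left_cancel)
  have hm: "h (- x) = - h x" if "x \<in> K" for x
    by (rule minus_unique[symmetric]) (use hh(1)[OF that cl(4)[OF that]] h0 in simp)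
  have z: "z \<in> K" "- z \<in> K" using insert cl by auto
  have IH: "coeff (\<Prod>y\<in>S. [:- y, 1:]) n \<in> K"
    "coeff (\<Prod>y\<in>S. [:- h y, 1:]) n = h (coeff (\<Prod>y\<in>S. [:- y, 1:]) n)" for n
    using insert by auto
  have e: "coeff (\<Prod>y\<in>insert z S. [:- y, 1:]) n =
    - z * coeff (\<Prod>y\<in>S. [:- y, 1:]) n + (if n = 0 then 0 else coeff (\<Prod>y\<in>S. [:- y, 1:]) (n - 1))"
    using insert(1,2) by (simp only: prod.insert coeff_linear_mult not_False_eq_True)
  have e': "coeff (\<Prod>y\<in>insert z S. [:- h y, 1:]) n =
    - h z * coeff (\<Prod>y\<in>S. [:- h y, 1:]) n + (if n = 0 then 0 else coeff (\<Prod>y\<in>S. [:- h y, 1:]) (n - 1))"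
    using insert(1,2) by (simp only: prod.insert coeff_linear_mult not_False_eq_True)
  have 1: "- z * coeff (\<Prod>y\<in>S. [:- y, 1:]) n \<in> K" by (rule cl(3)[OF z(2) IH(1)])
  have 2: "(if n = 0 then 0 else coeff (\<Prod>y\<in>S. [:- y, 1:]) (n - 1)) \<in> K" using cl(1) IH(1) by simp
  have 3: "h (- z * coeff (\<Prod>y\<in>S. [:- y, 1:]) n) = - h z * h (coeff (\<Prod>y\<in>S. [:- y, 1:]) n)"
    by (simp only: hh(2)[OF z(2) IH(1)] hm[OF z(1)])
  show ?case
    unfolding e e' IH(2) hh(1)[OF 1 2] 3 using cl(2)[OF 1 2] h0 by simp
qed

lemma hom_on_poly:
  assumes K: "is_subfield K" and h: "hom_on K h" "h 0 = 0"
    and E: "E \<subseteq> K" "\<And>x. x \<in> E \<Longrightarrow> h x = x" and x: "x \<in> K"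
    and p: "\<And>n. coeff p n \<in> E"
  shows "poly p x \<in> K \<and> poly p (h x) = h (poly p x)"
  using p
proof (induction p)
  case 0
  then show ?case using h K by (simp add: is_subfield_def)
next
  case (pCons a p)
  have "a \<in> E" using pCons(3)[of 0] by simp
  then have a: "a \<in> K" "h a = a" using E by auto
  have "coeff p n \<in> E" for n using pCons(3)[of "Suc n"] by simp
  then have IH: "poly p x \<in> K" "poly p (h x) = h (poly p x)" using pCons(2) by auto
  then have "x * poly p x \<in> K" "a + x * poly p x \<in> K" using K x a by (auto simp: is_subfield_def)
  moreover have "h (a + x * poly p x) = a + h x * h (poly p x)"
    using h(1) a x IH calculation by (simp add: hom_on_def)
  ultimately show ?case using IH by simp
qed

text \<open>A homomorphism fixing the base permutes the orbit of \<open>x\<close> under the automorphism group,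
  because the polynomial with this orbit as its root set has coefficients in the base.\<close>

lemma galois_ext_hom_image:
  assumes gal: "galois_ext E K" and E: "is_subfield E"
    and h: "hom_on K h" "inj_on h K" "\<And>x. x \<in> E \<Longrightarrow> h x = x"
  shows "h ` K = K"
proof -
  have K: "is_subfield K" and EK: "E \<subseteq> K" and alg: "algebraic_over E K"
    and fixed: "\<And>x. x \<in> K \<Longrightarrow> (\<And>\<sigma>. \<sigma> \<in> Aut_over K E \<Longrightarrow> \<sigma> x = x) \<Longrightarrow> x \<in> E"
    using gal by (auto simp: galois_ext_def)
  have E01: "0 \<in> E" "1 \<in> E" using E by (auto simp: is_subfield_def)
  have aut: "hom_on K \<sigma>" "inj_on \<sigma> K" "\<sigma> ` K = K" "\<And>x. x \<in> E \<Longrightarrow> \<sigma> x = x" if "\<sigma> \<in> Aut_over K E" for \<sigma>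
    using that by (auto simp: Aut_over_def hom_on_def bij_betw_def)
  have "x \<in> h ` K \<and> h x \<in> K" if x: "x \<in> K" for x
  proof -
    define W where "W = (\<lambda>\<sigma>. \<sigma> x) ` Aut_over K E"
    have OK: "W \<subseteq> K" using aut(3) x by (auto simp: W_def)
    have "id \<in> Aut_over K E" by (simp add: Aut_over_def)
    then have xO: "x \<in> W" unfolding W_def by (metis id_apply image_eqI)
    obtain p where p: "p \<noteq> 0" "\<And>n. coeff p n \<in> E" "poly p x = 0"
      using alg x by (auto simp: algebraic_over_def)
    have "poly p y = 0" if "y \<in> W" for y
    proof -
      obtain \<sigma> where s: "\<sigma> \<in> Aut_over K E" "y = \<sigma> x" using \<open>y \<in> W\<close> by (auto simp: W_def)
      have "\<sigma> 0 = 0" using aut(4)[OF s(1) E01(1)] .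
      then show ?thesis
        using hom_on_poly[OF K aut(1)[OF s(1)] _ EK aut(4)[OF s(1)] x p(2)] p(3) s(2) by simp
    qed
    \<comment> \<open>The orbit is finite because it consists of roots of p.\<close>
    then have finO: "finite W" using finite_subset[OF _ poly_roots_finite[OF p(1)]] by blast
    define q where "q = (\<Prod>y\<in>W. [:- y, 1:])"
    have root: "poly q z = 0 \<longleftrightarrow> z \<in> W" for z
      using finO by (auto simp: q_def poly_prod)
    have qE: "coeff q n \<in> E" for n
    proof (rule fixed)
      show "coeff q n \<in> K" unfolding q_def
        using hom_on_coeff_prod_roots[OF K _ _ finO OK, of id] by (simp add: hom_on_def)
      fix \<sigma> assume s: "\<sigma> \<in> Aut_over K E"
      have "\<sigma> ` W \<subseteq> W"
      proof
        fix z assume "z \<in> \<sigma> ` W"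
        then obtain \<rho> where r: "\<rho> \<in> Aut_over K E" "z = \<sigma> (\<rho> x)" by (auto simp: W_def)
        have "\<sigma> \<circ> \<rho> \<in> Aut_over K E"
          using s r(1) unfolding Aut_over_def by (auto intro: bij_betw_trans dest: bij_betwE)
        then show "z \<in> W" unfolding W_def r(2) by (metis comp_apply image_eqI)
      qed
      moreover have inj: "inj_on \<sigma> W" using aut(2)[OF s] OK inj_on_subset by blast
      ultimately have im: "\<sigma> ` W = W" using finO endo_inj_surj by blast
      have "(\<Prod>y\<in>W. [:- \<sigma> y, 1:]) = (\<Prod>y\<in>\<sigma> ` W. [:- y, 1:])"
        using inj by (simp add: prod.reindex)
      then show "\<sigma> (coeff q n) = coeff q n"
        using hom_on_coeff_prod_roots[OF K aut(1)[OF s] aut(4)[OF s E01(2)] finO OK, of n] im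
        by (simp add: q_def)
    qed
    have "(\<Prod>y\<in>W. [:- h y, 1:]) = q"
      by (rule poly_eqI)
        (use hom_on_coeff_prod_roots[OF K h(1) h(3)[OF E01(2)] finO OK] h(3)[OF qE] in \<open>simp add: q_def\<close>)
    then have "h ` W \<subseteq> W"
      using root finO by (force simp: poly_prod)
    moreover have "inj_on h W" using h(2) OK inj_on_subset by blast
    ultimately have "h ` W = W" using finO endo_inj_surj by blast
    then show ?thesis using xO OK by blast
  qed
  then show ?thesis by blast
qed


section \<open>The automorphism of F^(3)\<close>

context kummer_character
begin

lemma is_subfield_range: "is_subfield (range i)"
  unfolding is_subfield_def
  by (auto simp flip: i_add i_mult i_minus i_inverse intro: range_eqI[of _ _ 0] range_eqI[of _ _ 1])

lemma ex_automorphism_F3: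
  assumes minus_one: "\<chi> (-1) = 1"
  shows "\<exists>\<tau>\<in>Aut_over (F3 i) (F_sqrt_m1 i). \<forall>a. a \<noteq> 0 \<longrightarrow> chi_tau i \<tau> a = \<chi> a"
proof -
  obtain R where R: "twisted_embedding R" and max: "\<And>S. twisted_embedding S \<Longrightarrow> R \<subseteq> S \<Longrightarrow> S = R"
    using ex_maximal_twisted_embedding by blast
  have G: "embedding_graph R" and base: "(i a, i a) \<in> R" for a
    using R by (auto simp: twisted_embedding_def)
  note D = embedding_graphD[OF G]
  define M where "M = Domain R"
  have base_M: "i a \<in> M" for a using base unfolding M_def by blast
  \<comment> \<open>Outside the domain of R the value is unspecified; F^(3) will turn out to lie
    inside.\<close>
  define \<tau> where "\<tau> x = (THE x'. (x, x') \<in> R)" for x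
  have tau_eq: "\<tau> x = x'" if "(x, x') \<in> R" for x x'
    unfolding \<tau>_def using that embedding_graph_eq_iff[OF G that] by (intro the_equality) auto
  have tau: "(x, \<tau> x) \<in> R" if "x \<in> M" for x
    using that tau_eq unfolding M_def by auto
  have dom: "is_subfield (M)" unfolding M_def by (rule is_subfield_Domain[OF G])
  have tau_add: "\<tau> (x + y) = \<tau> x + \<tau> y" and tau_mult: "\<tau> (x * y) = \<tau> x * \<tau> y"
    if "x \<in> M" "y \<in> M" for x y
    using tau_eq[OF D(3)[OF tau tau]] tau_eq[OF D(4)[OF tau tau]] that by blast+
  have tau_minus: "\<tau> (- x) = - \<tau> x" and tau_inverse: "\<tau> (inverse x) = inverse (\<tau> x)"
    if "x \<in> M" for x
    using tau_eq[OF D(6)[OF tau]] tau_eq[OF D(7)[OF tau]] that by blast+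
  have tau_base: "\<tau> (i a) = i a" for a by (rule tau_eq[OF base])
  have tau_0: "\<tau> 0 = 0" and tau_1: "\<tau> 1 = 1" using tau_eq D(1,2) by auto
  have inj: "inj_on \<tau> (M)"
    using embedding_graph_eq_iff[OF G tau tau] by (auto simp: inj_on_def)
  have sqrt: "r \<in> M" if "r\<^sup>2 \<in> M" for r
    using maximal_closed_under_sqrt[OF R max] that unfolding M_def by blast
  have tau_root: "y \<in> M" "\<tau> y = of_int (\<chi> a) * y" if "a \<noteq> 0" "y\<^sup>2 = i a" for a y
  proof -
    show "y \<in> M" unfolding M_def by (rule maximal_contains_sqrt_of_base[OF R max that])
    then show "\<tau> y = of_int (\<chi> a) * y"
      using R that tau[of y] by (auto simp: twisted_embedding_def)
  qed
  have F2: "F2 i \<subseteq> M"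
    unfolding F2_def using base_M tau_root(1) by (intro field_gen_least[OF dom]) auto
  have quad: "K \<subseteq> M" if K: "quadratic_ext (F2 i) K" for K
  proof
    fix x assume "x \<in> K"
    then obtain p q where pq: "p \<in> F2 i" "q \<in> F2 i" "x\<^sup>2 - p * x + q = 0"
      using quadratic_ext_root[OF K] is_subfield_field_gen unfolding F2_def by blast
    note d = is_subfieldD[OF dom]
    have p: "p \<in> M" and q: "q \<in> M" using pq F2 by auto
    have "1 + 1 \<in> M" by (intro d)
    then have two: "2 \<in> M" by simp
    \<comment> \<open>Completing the square reduces x to a square root of p^2 - 4 q, and the domain
      is closed under square roots.\<close>
    have "(2 * x - p)\<^sup>2 = 2 * 2 * (x\<^sup>2 - p * x + q) + (p * p + - (2 * 2 * q))"
      by (simp add: power2_eq_square algebra_simps)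
    also have "\<dots> = p * p + - (2 * 2 * q)" using pq by simp
    also have "\<dots> \<in> M" by (intro d p q two)
    finally have "2 * x - p \<in> M" by (rule sqrt)
    then have "(2 * x - p + p) * inverse 2 \<in> M" by (intro d p two)
    then show "x \<in> M" using two_neq_zero by simp
  qed
  let ?U = "\<Union>{K. quadratic_ext (F2 i) K \<and> galois_ext (range i) K}"
  have F3: "F3 i \<subseteq> M"
    unfolding F3_def using quad by (intro field_gen_least[OF dom]) blast
  have F3_field: "is_subfield (F3 i)" unfolding F3_def by (rule is_subfield_field_gen)
  have U: "?U \<subseteq> F3 i" unfolding F3_def by (rule field_gen_superset)
  have fix_K: "\<tau> ` K = K" if K: "quadratic_ext (F2 i) K" "galois_ext (range i) K" for K
  proof (rule galois_ext_hom_image[OF K(2) is_subfield_range])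
    show "hom_on K \<tau>" using quad[OF K(1)] tau_add tau_mult by (auto simp: hom_on_def subset_iff)
    show "inj_on \<tau> K" using inj quad[OF K(1)] inj_on_subset by blast
    show "\<tau> x = x" if "x \<in> range i" for x using that tau_base by auto
  qed
  note closed = is_subfieldD[OF F3_field]
  \<comment> \<open>The image of F^(3) is a field containing every generating K, hence all of F^(3).
    The set of x mapped into F^(3) is treated likewise below.\<close>
  have "is_subfield (\<tau> ` F3 i)"
    unfolding is_subfield_def
  proof (intro conjI ballI)
    show "0 \<in> \<tau> ` F3 i" "1 \<in> \<tau> ` F3 i" using closed(1,2) tau_0 tau_1 by (metis image_eqI)+
    fix x assume "x \<in> \<tau> ` F3 i"
    then obtain u where u: "u \<in> F3 i" "x = \<tau> u" by blast
    have "- x = \<tau> (- u)" "inverse x = \<tau> (inverse u)" using u F3 tau_minus tau_inverse by auto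
    then show "- x \<in> \<tau> ` F3 i" "inverse x \<in> \<tau> ` F3 i" using closed u by auto
    fix y assume "y \<in> \<tau> ` F3 i"
    then obtain v where v: "v \<in> F3 i" "y = \<tau> v" by blast
    have "x + y = \<tau> (u + v)" "x * y = \<tau> (u * v)"
      using u v F3 tau_add tau_mult by (auto simp: subset_iff)
    then show "x + y \<in> \<tau> ` F3 i" "x * y \<in> \<tau> ` F3 i" using closed u v by auto
  qed
  moreover have "?U \<subseteq> \<tau> ` F3 i" using fix_K U by blast
  ultimately have surj: "F3 i \<subseteq> \<tau> ` F3 i"
    unfolding F3_def[of i] by (rule field_gen_least)
  have "is_subfield {x \<in> F3 i. \<tau> x \<in> F3 i}"
    unfolding is_subfield_def
    using F3 closed tau_0 tau_1 tau_add tau_mult tau_minus tau_inverse by (auto simp: subset_iff)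
  moreover have "?U \<subseteq> {x \<in> F3 i. \<tau> x \<in> F3 i}" using fix_K U by blast
  ultimately have "F3 i \<subseteq> {x \<in> F3 i. \<tau> x \<in> F3 i}"
    unfolding F3_def[of i] by (rule field_gen_least)
  then have bij: "bij_betw \<tau> (F3 i) (F3 i)"
    using surj inj F3 inj_on_subset unfolding bij_betw_def by blast
  have "is_subfield {x \<in> M. \<tau> x = x}"
    using dom tau_0 tau_1 tau_add tau_mult tau_minus tau_inverse
    unfolding is_subfield_def by auto
  \<comment> \<open>Here \<chi>(-1) = 1 keeps the square roots of -1 fixed.\<close>
  moreover have "range i \<union> {y. y\<^sup>2 = - 1} \<subseteq> {x \<in> M. \<tau> x = x}"
    using base_M tau_base tau_root[of "-1"] minus_one by (auto simp: i_minus)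
  ultimately have fixed: "F_sqrt_m1 i \<subseteq> {x \<in> M. \<tau> x = x}"
    unfolding F_sqrt_m1_def by (rule field_gen_least)
  have "\<tau> \<in> Aut_over (F3 i) (F_sqrt_m1 i)"
    unfolding Aut_over_def using bij fixed F3 tau_add tau_mult by (auto simp: subset_iff)
  moreover have "chi_tau i \<tau> a = \<chi> a" if a: "a \<noteq> 0" for a
  proof -
    have r: "(sqrtL i a)\<^sup>2 = i a" unfolding sqrtL_def using ex_sqrt by (rule someI_ex)
    then have "sqrtL i a \<noteq> 0" using a by auto
    then have "\<tau> (sqrtL i a) / sqrtL i a = of_int (\<chi> a)" using tau_root(2)[OF a r] by simp
    \<comment> \<open>As 1 and -1 are distinct in the large field, \<open>chi_tau\<close> recovers
      the sign.\<close>
    moreover have "(- 1 :: 'b) \<noteq> 1" using two_neq_zero by (metis add.right_inverse one_add_one)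
    ultimately show ?thesis using chi_cases[of a] a by (auto simp: chi_tau_def)
  qed
  ultimately show ?thesis by blast
qed

end

section \<open>Conclusion: the translation realised by an automorphism\<close>

theorem theorem3p6:
  fixes i :: "'a::field_char_0 \<Rightarrow> 'b::field"
  assumes "pythagorean TYPE('a)"
    and "formally_real TYPE('a)"
    and "finite {P::'a set. is_ordering P}"
    and "connected_space (X\<^sub>F TYPE('a))"
    and "rank_chars (X\<^sub>F TYPE('a)) \<noteq> 1"
    and "alg_closed TYPE('b)"
    and "field_embedding i"
  shows "\<exists>\<tau>\<in>Aut_over (F3 i) (F_sqrt_m1 i).
           chi_tau i \<tau> \<noteq> (\<lambda>_. 1) \<and>
           (\<lambda>\<sigma>. char_mult (chi_tau i \<tau>) \<sigma>) ` (X\<^sub>F TYPE('a)) = X\<^sub>F TYPE('a)"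
proof -
  let ?X = "X\<^sub>F TYPE('a)"
  have fin: "finite ?X" using assms(3) by (simp add: space_of_orderings_def)
  obtain s0 where s0: "s0 \<in> ?X" using assms(4) by (auto simp: connected_space_def)
  have "?X \<noteq> {s0}"
    using rank_chars_singleton[of s0] s0 assms(5) by (auto simp: space_of_orderings_iff)
  then obtain t0 where t0: "t0 \<in> ?X" "s0 \<noteq> t0" using s0 by blast
  obtain t t' where t: "sign_char t" "sign_char t'" "t \<noteq> t'"
    and twist: "\<And>s. s \<in> ?X \<Longrightarrow> char_mult (char_mult t t') s \<in> ?X"
    using connected_space_translation[OF _ fin assms(4) s0 t0] by (auto simp: space_of_orderings_iff)
  interpret t: sign_char t by fact
  interpret t': sign_char t' by fact
  define \<gamma> where "\<gamma> = char_mult t t'"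
  have g_cases: "\<gamma> a = 1 \<or> \<gamma> a = -1" for a
    using t.cases[of a] t'.cases[of a] by (auto simp: \<gamma>_def char_mult_def)
  interpret kummer_character i \<gamma>
  proof
    show "\<gamma> (a * b) = \<gamma> a * \<gamma> b" if "a \<noteq> 0" "b \<noteq> 0" for a b
      using that by (simp add: \<gamma>_def char_mult_def t.mult t'.mult)
  qed (use assms g_cases in auto)
  \<comment> \<open>Both orderings are negative at -1; this is what places \<tau> over
    F(sqrt(-1)).\<close>
  have "\<gamma> (-1) = 1" by (simp add: \<gamma>_def char_mult_def t.minus_one t'.minus_one)
  then obtain \<tau> where tau: "\<tau> \<in> Aut_over (F3 i) (F_sqrt_m1 i)" "\<And>a. a \<noteq> 0 \<Longrightarrow> chi_tau i \<tau> a = \<gamma> a"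
    using ex_automorphism_F3 by blast
  have chi: "chi_tau i \<tau> = \<gamma>"
  proof
    fix a show "chi_tau i \<tau> a = \<gamma> a"
      using tau(2)[of a] by (cases "a = 0") (auto simp: chi_tau_def \<gamma>_def char_mult_def)
  qed
  have "\<gamma> \<noteq> (\<lambda>_. 1)"
  proof
    assume g: "\<gamma> = (\<lambda>_. 1)"
    have "t a = t' a" for a
      using fun_cong[OF g, of a] t.cases[of a] t'.cases[of a] by (auto simp: \<gamma>_def char_mult_def)
    then show False using t(3) by blast
  qed
  moreover have "char_mult \<gamma> ` ?X = ?X"
  proof
    show "char_mult \<gamma> ` ?X \<subseteq> ?X" using twist by (auto simp: \<gamma>_def)
    \<comment> \<open>Multiplication by \<open>\<gamma>\<close> is an involution, so mapping the
      space into itself already gives equality.\<close>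
    have "char_mult \<gamma> (char_mult \<gamma> s) = s" for s
    proof
      fix a show "char_mult \<gamma> (char_mult \<gamma> s) a = s a"
        using g_cases[of a] by (auto simp: char_mult_def)
    qed
    then show "?X \<subseteq> char_mult \<gamma> ` ?X" using twist unfolding \<gamma>_def by (metis image_eqI subsetI)
  qed
  ultimately show ?thesis using tau(1) chi by (intro bexI[of _ \<tau>]) simp_all
qed

end
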